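(* Let $M$ be a four-dimensional Riemann-Cartan space-time manifold with coordinates $(t,x,y,z)$, endowed with the Gödel-type metric $$ds^2=[dt+H(x)\,dy]^2-D^2(x)\,dy^2-dx^2-dz^2$$ and with the torsion whose only nonvanishing coordinate component (up to antisymmetry in the two lower indices) is $$T^t_{\ xy}=D(x)\,S(z),$$ where $H(x)$, $D(x)$, $S(z)$ are smooth real functions and $D$ is nowhere zero. Suppose that $$\frac{H'}{D}=\text{const}\equiv 2\omega,\qquad \frac{D''}{D}=\text{const}\equiv m^2$$ (prime denoting the derivative with respect to $x$), and that $S$ is not constant. Then the group of affine-isometric motions of $M$ is four-dimensional, with a one-dimensional isotropy subgroup, and the orbit of an arbitrary point $P\in M$ under this group is three-dimensional; in particular $M$ is not space-time homogeneous.
   Context: A Riemann-Cartan space-time manifold is a smooth four-dimensional manifold with a Lorentzian metric $g$ and a metric-compatible, not necessarily symmetric, connection $\Gamma$. The connection is determined by $g$ and the torsion tensor $T$, which is antisymmetric in its two lower indices. The coordinates range over $t,y\in\mathbb{R}$ and $x,z$ in open intervals on which the functions are defined. Equivalently, in the coframe $\omega^0=dt+H(x)\,dy$, $\omega^1=dx$, $\omega^2=D(x)\,dy$, $\omega^3=dz$, the metric is $\eta_{AB}\omega^A\omega^B$ with $\eta=\mathrm{diag}(+1,-1,-1,-1)$, and the only nonvanishing torsion component (up to antisymmetry) is $T^0_{\ 12}=S(z)$; that is, $T=S(z)\,\partial_t\otimes(\omega^1\wedge\omega^2)$. An affine-isometric motion is a (local) diffeomorphism preserving both the metric and the connection (equivalently,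 the metric and the torsion). The group of affine-isometric motions is understood as a local group, with Lie algebra the vector fields $X$ on the coordinate domain satisfying $\mathcal{L}_Xg=0$ and $\mathcal{L}_XT=0$. Its dimension is the dimension of this Lie algebra. The orbit dimension at $P$ is the dimension of the span at $P$ of these vector fields, and the isotropy subgroup at $P$ corresponds to those vanishing at $P$. $M$ is space-time homogeneous if the orbit of every point is $M$ itself. $m^2$ is the name of a real constant; no sign restriction is imposed on it. *)

theory Defs
  imports "HOL-Analysis.Analysis" "HOL-Library.Function_Algebras"
begin

text \<open>
  Points, coordinate vectors and tensor indices are indexed by the type \<^typ>\<open>4\<close>; the coordinates
  \<open>(t, x, y, z)\<close> have indices \<open>0, 1, 2, 3\<close>.  (Numerals of type \<^typ>\<open>4\<close> are taken modulo 4, so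
  \<open>4 = 0\<close> and these four values are all of it.)  All fields are total functions on \<^typ>\<open>real ^ 4\<close>;
  only their values on the open coordinate domain \<open>U\<close> are meaningful.
\<close>

type_synonym point = "real ^ 4"
type_synonym vfield = "point \<Rightarrow> real ^ 4"
type_synonym tensor2 = "point \<Rightarrow> 4 \<Rightarrow> 4 \<Rightarrow> real"
type_synonym tensor3 = "point \<Rightarrow> 4 \<Rightarrow> 4 \<Rightarrow> 4 \<Rightarrow> real"

subsection \<open>Smooth functions on open sets\<close>

primrec Ck_on :: "nat \<Rightarrow> 'a set \<Rightarrow> ('a::euclidean_space \<Rightarrow> 'b::real_normed_vector) \<Rightarrow> bool" where
  "Ck_on 0 U f \<longleftrightarrow> continuous_on U f"
| "Ck_on (Suc k) U f \<longleftrightarrow>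
     (\<forall>p\<in>U. f differentiable (at p)) \<and> (\<forall>v. Ck_on k U (\<lambda>p. frechet_derivative f (at p) v))"

definition smooth_on :: "'a set \<Rightarrow> ('a::euclidean_space \<Rightarrow> 'b::real_normed_vector) \<Rightarrow> bool" where
  "smooth_on U f \<longleftrightarrow> (\<forall>k. Ck_on k U f)"

definition pderiv :: "4 \<Rightarrow> (point \<Rightarrow> real) \<Rightarrow> point \<Rightarrow> real" where
  "pderiv i f p = frechet_derivative f (at p) (axis i 1)"

subsection \<open>Riemann-Cartan structures on a coordinate domain\<close>

definition metric_prod :: "tensor2 \<Rightarrow> point \<Rightarrow> real ^ 4 \<Rightarrow> real ^ 4 \<Rightarrow> real" where
  "metric_prod g p u v = (\<Sum>a\<in>UNIV. \<Sum>b\<in>UNIV. g p a b * u $ a * v $ b)"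

definition minkowski :: "4 \<Rightarrow> 4 \<Rightarrow> real" where
  "minkowski A B = (if A \<noteq> B then 0 else if A = 0 then 1 else - 1)"

definition lorentzian_on :: "point set \<Rightarrow> tensor2 \<Rightarrow> bool" where
  "lorentzian_on U g \<longleftrightarrow>
     (\<forall>a b. smooth_on U (\<lambda>p. g p a b)) \<and>
     (\<forall>p\<in>U. (\<forall>a b. g p a b = g p b a) \<and>
            (\<exists>e :: 4 \<Rightarrow> real ^ 4. \<forall>A B. metric_prod g p (e A) (e B) = minkowski A B))"

text \<open>
  A connection is given by its coefficients: \<open>\<Gamma> p a b c\<close> is \<open>\<Gamma>\<^sup>a\<^bsub>bc\<^esub>\<close> with
  \<open>\<nabla>\<^bsub>\<partial>b\<^esub> \<partial>\<^sub>c = \<Gamma>\<^sup>a\<^bsub>bc\<^esub> \<partial>\<^sub>a\<close>, the differentiation index being the first lower one.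
\<close>

definition metric_compatible_on :: "point set \<Rightarrow> tensor2 \<Rightarrow> tensor3 \<Rightarrow> bool" where
  "metric_compatible_on U g \<Gamma> \<longleftrightarrow>
     (\<forall>p\<in>U. \<forall>c a b.
        pderiv c (\<lambda>q. g q a b) p
          - (\<Sum>d\<in>UNIV. \<Gamma> p d c a * g p d b) - (\<Sum>d\<in>UNIV. \<Gamma> p d c b * g p a d) = 0)"

definition torsion :: "tensor3 \<Rightarrow> tensor3" where
  "torsion \<Gamma> p a b c = \<Gamma> p a b c - \<Gamma> p a c b"

definition riemann_cartan_on :: "point set \<Rightarrow> tensor2 \<Rightarrow> tensor3 \<Rightarrow> bool" where
  "riemann_cartan_on U g \<Gamma> \<longleftrightarrow>
     lorentzian_on U g \<and>
     (\<forall>a b c. smooth_on U (\<lambda>p. \<Gamma> p a b c)) \<and>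
     metric_compatible_on U g \<Gamma>"

subsection \<open>Lie derivatives and infinitesimal affine-isometric motions\<close>

definition lie_metric :: "vfield \<Rightarrow> tensor2 \<Rightarrow> tensor2" where
  "lie_metric X g p a b =
     (\<Sum>c\<in>UNIV. X p $ c * pderiv c (\<lambda>q. g q a b) p
        + g p c b * pderiv a (\<lambda>q. X q $ c) p
        + g p a c * pderiv b (\<lambda>q. X q $ c) p)"

text \<open>For a tensor \<open>T\<^sup>a\<^bsub>bc\<^esub>\<close> of type (1,2).\<close>

definition lie_torsion :: "vfield \<Rightarrow> tensor3 \<Rightarrow> tensor3" where
  "lie_torsion X T p a b c =
     (\<Sum>d\<in>UNIV. X p $ d * pderiv d (\<lambda>q. T q a b c) p
        - T p d b c * pderiv d (\<lambda>q. X q $ a) p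
        + T p a d c * pderiv b (\<lambda>q. X q $ d) p
        + T p a b d * pderiv c (\<lambda>q. X q $ d) p)"

text \<open>
  Requiring the fields to vanish outside \<open>U\<close> makes the total function \<open>X\<close> determined by the vector
  field on \<open>U\<close> that it represents, so that linear independence of functions is linear
  independence of vector fields on \<open>U\<close>.
\<close>

definition affine_isometry_algebra :: "point set \<Rightarrow> tensor2 \<Rightarrow> tensor3 \<Rightarrow> vfield set" where
  "affine_isometry_algebra U g \<Gamma> =
     {X. smooth_on U X \<and> (\<forall>p. p \<notin> U \<longrightarrow> X p = 0) \<and>
         (\<forall>p\<in>U. \<forall>a b. lie_metric X g p a b = 0) \<and>
         (\<forall>p\<in>U. \<forall>a b c. lie_torsion X (torsion \<Gamma>) p a b c = 0)}"

definition isotropy_algebra :: "vfield set \<Rightarrow> point \<Rightarrow> vfield set" where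
  "isotropy_algebra A P = {X \<in> A. X P = 0}"

definition orbit_dim :: "vfield set \<Rightarrow> point \<Rightarrow> nat" where
  "orbit_dim A P = dim (span ((\<lambda>X. X P) ` A))"

text \<open>
  The orbit of \<open>P\<close> under the local group generated by \<open>A\<close>: all points reached from \<open>P\<close> by
  successively following the local flows of fields in \<open>A\<close> inside \<open>U\<close>.
\<close>

inductive_set local_orbit :: "point set \<Rightarrow> vfield set \<Rightarrow> point \<Rightarrow> point set"
  for U :: "point set" and A :: "vfield set" and P :: point where
  start: "P \<in> local_orbit U A P"
| flow: "\<gamma> \<tau> \<in> local_orbit U A P"
    if "\<gamma> 0 \<in> local_orbit U A P" and "X \<in> A" and "0 \<le> \<tau>"
      and "\<And>s. s \<in> {0..\<tau>} \<Longrightarrow> \<gamma> s \<in> U"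
      and "\<And>s. s \<in> {0..\<tau>} \<Longrightarrow> (\<gamma> has_vector_derivative X (\<gamma> s)) (at s within {0..\<tau>})"

definition homogeneous_on :: "point set \<Rightarrow> vfield set \<Rightarrow> bool" where
  "homogeneous_on U A \<longleftrightarrow> (\<forall>P\<in>U. local_orbit U A P = U)"

subsection \<open>Vector fields as a real vector space\<close>

text \<open>
  The library has no \<^class>\<open>real_vector\<close> instance for functions; the pointwise structure gives
  \<open>vf.dim\<close>, the dimension of the linear span.
\<close>

definition vf_scale :: "real \<Rightarrow> vfield \<Rightarrow> vfield" where
  "vf_scale c X = (\<lambda>p. c *\<^sub>R X p)"

interpretation vf: vector_space vf_scale
  by unfold_locales (auto simp: vf_scale_def fun_eq_iff algebra_simps)

lemma Ck_on_cong:
  assumes "open U" "\<And>p. p \<in> U \<Longrightarrow> f p = g p" "Ck_on k U f"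
  shows "Ck_on k U g"
  using assms(2,3)
proof (induction k arbitrary: f g)
  case 0
  then show ?case by (simp cong: continuous_on_cong)
next
  case (Suc k)
  have fd: "f differentiable (at p)" if "p \<in> U" for p
    using Suc.prems that by simp
  have gd: "g differentiable (at p)" if "p \<in> U" for p
    using fd[OF that] Suc.prems(1) assms(1) that
    by (meson differentiable_def has_derivative_transform_within_open)
  have eq: "frechet_derivative f (at p) = frechet_derivative g (at p)" if "p \<in> U" for p
    by (rule frechet_derivative_transform_within_open[OF fd[OF that] assms(1) that])
      (use Suc.prems in auto)
  have "Ck_on k U (\<lambda>p. frechet_derivative g (at p) v)" for v
    by (rule Suc.IH[of "\<lambda>p. frechet_derivative f (at p) v"]) (use Suc.prems eq in auto)
  with gd show ?case by simp
qed

lemma Ck_on_lincomb: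
  assumes "open U" "Ck_on k U f" "Ck_on k U g"
  shows "Ck_on k U (\<lambda>p. a *\<^sub>R f p + b *\<^sub>R g p)"
  using assms(2,3)
proof (induction k arbitrary: f g)
  case 0
  then show ?case by (auto intro!: continuous_intros)
next
  case (Suc k)
  have der: "((\<lambda>p. a *\<^sub>R f p + b *\<^sub>R g p) has_derivative
      (\<lambda>v. a *\<^sub>R frechet_derivative f (at p) v + b *\<^sub>R frechet_derivative g (at p) v)) (at p)"
    if "p \<in> U" for p
    using Suc.prems that by (auto intro!: derivative_intros simp: frechet_derivative_works)
  have eq: "frechet_derivative (\<lambda>p. a *\<^sub>R f p + b *\<^sub>R g p) (at p) =
      (\<lambda>v. a *\<^sub>R frechet_derivative f (at p) v + b *\<^sub>R frechet_derivative g (at p) v)"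
    if "p \<in> U" for p
    using frechet_derivative_at[OF der[OF that]] by simp
  have "Ck_on k U (\<lambda>p. frechet_derivative (\<lambda>p. a *\<^sub>R f p + b *\<^sub>R g p) (at p) v)" for v
    by (rule Ck_on_cong[OF assms(1), of
          "\<lambda>p. a *\<^sub>R frechet_derivative f (at p) v + b *\<^sub>R frechet_derivative g (at p) v"])
      (use Suc eq in auto)
  moreover have "(\<lambda>p. a *\<^sub>R f p + b *\<^sub>R g p) differentiable (at p)" if "p \<in> U" for p
    using der[OF that] by (auto simp: differentiable_def)
  ultimately show ?case by simp
qed

lemma smooth_on_component_differentiable:
  assumes "smooth_on U (X :: vfield)" "p \<in> U"
  shows "(\<lambda>q. X q $ i) differentiable (at p)"
proof -
  have "Ck_on (Suc 0) U X"
    using assms by (simp only: smooth_on_def)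
  then have "X differentiable (at p)"
    using assms(2) by simp
  then show ?thesis
    using bounded_linear.has_derivative[OF bounded_linear_vec_nth]
    unfolding differentiable_def by blast
qed

lemma pderiv_lincomb:
  assumes "f differentiable (at p)" "g differentiable (at p)"
  shows "pderiv i (\<lambda>q. a * f q + b * g q) p = a * pderiv i f p + b * pderiv i g p"
proof -
  have "((\<lambda>q. a * f q + b * g q) has_derivative
      (\<lambda>v. a * frechet_derivative f (at p) v + b * frechet_derivative g (at p) v)) (at p)"
    using assms by (auto intro!: derivative_eq_intros simp: frechet_derivative_works)
  from frechet_derivative_at[OF this] show ?thesis
    by (simp add: pderiv_def fun_eq_iff)
qed

lemma affine_isometry_algebra_lincomb:
  assumes U: "open U"
    and X: "X \<in> affine_isometry_algebra U g \<Gamma>" and Y: "Y \<in> affine_isometry_algebra U g \<Gamma>"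
  shows "(\<lambda>p. r *\<^sub>R X p + s *\<^sub>R Y p) \<in> affine_isometry_algebra U g \<Gamma>"
proof -
  have sm: "smooth_on U X" "smooth_on U Y"
    using X Y by (auto simp: affine_isometry_algebra_def)
  let ?Z = "\<lambda>p. r *\<^sub>R X p + s *\<^sub>R Y p"
  have "smooth_on U ?Z"
    using sm Ck_on_lincomb[OF U, of _ X Y r s] unfolding smooth_on_def by blast
  have pd: "pderiv i (\<lambda>q. ?Z q $ c) p =
      r * pderiv i (\<lambda>q. X q $ c) p + s * pderiv i (\<lambda>q. Y q $ c) p" if "p \<in> U" for i c p
    using pderiv_lincomb[OF smooth_on_component_differentiable[OF sm(1) that]
        smooth_on_component_differentiable[OF sm(2) that]] by simp
  have "lie_metric ?Z g p a b = r * lie_metric X g p a b + s * lie_metric Y g p a b"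
    if "p \<in> U" for p a b
    unfolding lie_metric_def pd[OF that] sum_distrib_left sum.distrib[symmetric]
    by (intro sum.cong) (simp_all add: algebra_simps)
  moreover have "lie_torsion ?Z T p a b c = r * lie_torsion X T p a b c + s * lie_torsion Y T p a b c"
    if "p \<in> U" for T p a b c
    unfolding lie_torsion_def pd[OF that] sum_distrib_left sum.distrib[symmetric]
    by (intro sum.cong) (simp_all add: algebra_simps)
  ultimately show ?thesis
    using X Y \<open>smooth_on U ?Z\<close> by (auto simp: affine_isometry_algebra_def)
qed

lemma Ck_on_zero: "Ck_on k U (\<lambda>p. 0)"
  by (induction k) auto

lemma subspace_affine_isometry_algebra:
  assumes "open U"
  shows "vf.subspace (affine_isometry_algebra U g \<Gamma>)"
proof (rule vf.subspaceI)
  show "0 \<in> affine_isometry_algebra U g \<Gamma>"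
    by (auto simp: affine_isometry_algebra_def smooth_on_def zero_fun_def Ck_on_zero
        lie_metric_def lie_torsion_def pderiv_def)
next
  fix X Y assume "X \<in> affine_isometry_algebra U g \<Gamma>" "Y \<in> affine_isometry_algebra U g \<Gamma>"
  from affine_isometry_algebra_lincomb[OF assms this, of 1 1]
  show "X + Y \<in> affine_isometry_algebra U g \<Gamma>" by (simp add: plus_fun_def)
next
  fix c X assume "X \<in> affine_isometry_algebra U g \<Gamma>"
  from affine_isometry_algebra_lincomb[OF assms this this, of c 0]
  show "vf_scale c X \<in> affine_isometry_algebra U g \<Gamma>" by (simp add: vf_scale_def)
qed

end

theory Submission
  imports Defs
begin

text \<open>
  Evaluated where \<open>S S' \<noteq> 0\<close>, the Lie equations of metric and torsion force \<open>X\<^sup>z = 0\<close>, and then \<open>X\<close>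
  depends on \<open>(x, y)\<close> only.  What remains is Killing's equation on the surface \<open>dx\<^sup>2 + D\<^sup>2 dy\<^sup>2\<close> for
  \<open>(X\<^sup>x, X\<^sup>y)\<close>, together with a lift to \<open>X\<^sup>t\<close> that is unique up to a multiple of \<open>\<partial>\<^sub>t\<close>.  Here
  \<open>X\<^sup>x = b(y)\<close> with \<open>b'' = k b\<close>, where \<open>k = m\<^sup>2 D\<^sup>2 - D'\<^sup>2\<close> is constant, so the system is integrable,
  and a solution is determined by the values of \<open>X\<^sup>t\<close>, \<open>X\<^sup>x\<close>, \<open>X\<^sup>y\<close>, \<open>\<partial>\<^sub>y X\<^sup>x\<close> at a single point:
  the first three span the orbit directions, the last one is the isotropy.
\<close>

subsection \<open>Closure properties of smooth functions\<close>

text \<open>\<open>Ck_on\<close> is phrased with \<open>frechet_derivative\<close>; on an open set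
  any derivative \<open>f'\<close> known in closed form may take its place, and the later closure
  proofs all work through this.\<close>

lemma Ck_on_SucI:
  assumes "open U" "\<And>p. p \<in> U \<Longrightarrow> (f has_derivative f' p) (at p)"
    and "\<And>v. Ck_on k U (\<lambda>p. f' p v)"
  shows "Ck_on (Suc k) U f"
proof -
  have eq: "frechet_derivative f (at p) = f' p" if "p \<in> U" for p
    using frechet_derivative_at[OF assms(2)[OF that]] by simp
  have "Ck_on k U (\<lambda>p. frechet_derivative f (at p) v)" for v
    by (rule Ck_on_cong[OF assms(1) _ assms(3)[of v]]) (simp add: eq)
  then show ?thesis
    using assms(2) unfolding Ck_on.simps differentiable_def by blast
qed

lemma Ck_on_Suc_imp: "Ck_on (Suc k) U f \<Longrightarrow> Ck_on k U f"
proof (induction k arbitrary: f)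
  case 0
  then show ?case
    by (auto intro!: continuous_at_imp_continuous_on differentiable_imp_continuous_within)
next
  case (Suc k)
  then show ?case unfolding Ck_on.simps(2)[of "Suc k"] Ck_on.simps(2)[of k U f] by blast
qed

lemma Ck_on_const: "Ck_on k U (\<lambda>p. c)"
  by (cases k) (auto simp: Ck_on_zero)

lemma Ck_on_mult:
  fixes f g :: "'a::euclidean_space \<Rightarrow> real"
  assumes "open U" "Ck_on k U f" "Ck_on k U g"
  shows "Ck_on k U (\<lambda>p. f p * g p)"
  using assms(2,3)
proof (induction k arbitrary: f g)
  case 0
  then show ?case by (auto intro!: continuous_intros)
next
  case (Suc k)
  let ?f' = "\<lambda>p. frechet_derivative f (at p)" and ?g' = "\<lambda>p. frechet_derivative g (at p)"
  have "((\<lambda>p. f p * g p) has_derivative (\<lambda>v. f p * ?g' p v + ?f' p v * g p)) (at p)"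
    if "p \<in> U" for p
    using Suc.prems that by (intro has_derivative_mult) (auto simp: frechet_derivative_works)
  moreover have "Ck_on k U (\<lambda>p. f p * ?g' p v + ?f' p v * g p)" for v
    using Ck_on_lincomb[OF assms(1) Suc.IH[of f "\<lambda>p. ?g' p v"] Suc.IH[of "\<lambda>p. ?f' p v" g], of 1 1]
      Ck_on_Suc_imp[OF Suc.prems(1)] Ck_on_Suc_imp[OF Suc.prems(2)] Suc.prems by simp
  ultimately show ?case
    by (rule Ck_on_SucI[OF assms(1)])
qed

lemma Ck_on_linear:
  assumes "open U" "bounded_linear L" "Ck_on k U f"
  shows "Ck_on k U (\<lambda>p. L (f p))"
  using assms(3)
proof (induction k arbitrary: f)
  case 0
  then show ?case using bounded_linear.continuous_on[OF assms(2)] by auto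
next
  case (Suc k)
  have "((\<lambda>p. L (f p)) has_derivative (\<lambda>v. L (frechet_derivative f (at p) v))) (at p)"
    if "p \<in> U" for p
    using Suc.prems that
    by (intro bounded_linear.has_derivative[OF assms(2)]) (auto simp: frechet_derivative_works)
  then show ?case
    by (rule Ck_on_SucI[OF assms(1)]) (use Suc in auto)
qed

lemma Ck_on_compose_nth:
  fixes \<phi> :: "real \<Rightarrow> real" and U :: "(real ^ 'n) set"
  assumes "open U" "\<And>p. p \<in> U \<Longrightarrow> p $ i \<in> I" "Ck_on k I \<phi>"
  shows "Ck_on k U (\<lambda>p. \<phi> (p $ i))"
  using assms(3)
proof (induction k arbitrary: \<phi>)
  case 0
  have "continuous_on U (\<lambda>p. p $ i)" by (intro continuous_intros)
  then show ?case using 0 assms(2) by (auto intro: continuous_on_compose2)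
next
  case (Suc k)
  let ?d = "\<lambda>x. frechet_derivative \<phi> (at x)"
  \<comment> \<open>The summand \<open>0 *\<^sub>R 0\<close> only gives the derivative the two-term
    shape that \<open>Ck_on_lincomb\<close> expects.\<close>
  have "((\<lambda>p. \<phi> (p $ i)) has_derivative (\<lambda>v. v $ i *\<^sub>R ?d (p $ i) 1 + 0 *\<^sub>R 0)) (at p)" if "p \<in> U" for p
  proof -
    have "(\<phi> has_derivative ?d (p $ i)) (at (p $ i))"
      using Suc.prems assms(2) that by (auto simp: frechet_derivative_works)
    from has_derivative_compose[OF bounded_linear_imp_has_derivative[OF bounded_linear_vec_nth] this]
    have "((\<lambda>p. \<phi> (p $ i)) has_derivative (\<lambda>v. ?d (p $ i) (v $ i))) (at p)" .
    moreover have "?d (p $ i) (v $ i) = v $ i *\<^sub>R ?d (p $ i) 1" for v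
      using linear_scale[OF linear_frechet_derivative, of \<phi> "at (p $ i)" "v $ i" 1]
        Suc.prems assms(2) that by auto
    ultimately show ?thesis by (simp add: fun_eq_iff)
  qed
  moreover have "Ck_on k U (\<lambda>p. v $ i *\<^sub>R ?d (p $ i) 1 + 0 *\<^sub>R 0)" for v
    using Suc.IH[of "\<lambda>x. ?d x 1"] Suc.prems by (intro Ck_on_lincomb[OF assms(1)] Ck_on_const) simp
  ultimately show ?case
    by (rule Ck_on_SucI[OF assms(1)])
qed

lemma smooth_on_cong:
  assumes "open U" "\<And>p. p \<in> U \<Longrightarrow> f p = g p" "smooth_on U f"
  shows "smooth_on U g"
  using Ck_on_cong[OF assms(1), of f g] assms(2,3) by (simp add: smooth_on_def)

lemma smooth_on_const: "smooth_on U (\<lambda>p. c)"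
  by (simp add: smooth_on_def Ck_on_const)

lemma smooth_on_add:
  assumes "open U" "smooth_on U f" "smooth_on U g"
  shows "smooth_on U (\<lambda>p. f p + g p)"
  using Ck_on_lincomb[OF assms(1), of _ f g 1 1] assms(2,3) by (simp add: smooth_on_def)

lemma smooth_on_diff:
  assumes "open U" "smooth_on U f" "smooth_on U g"
  shows "smooth_on U (\<lambda>p. f p - g p)"
  using Ck_on_lincomb[OF assms(1), of _ f g 1 "-1"] assms(2,3) by (simp add: smooth_on_def)

lemma smooth_on_mult:
  fixes f g :: "'a::euclidean_space \<Rightarrow> real"
  assumes "open U" "smooth_on U f" "smooth_on U g"
  shows "smooth_on U (\<lambda>p. f p * g p)"
  using Ck_on_mult[OF assms(1)] assms(2,3) by (simp add: smooth_on_def)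

lemma smooth_on_compose_nth:
  fixes \<phi> :: "real \<Rightarrow> real" and U :: "(real ^ 'n) set"
  assumes "open U" "\<And>p. p \<in> U \<Longrightarrow> p $ i \<in> I" "smooth_on I \<phi>"
  shows "smooth_on U (\<lambda>p. \<phi> (p $ i))"
  using Ck_on_compose_nth[OF assms(1,2)] assms(3) by (simp add: smooth_on_def)

lemma smooth_on_imp_differentiable:
  assumes "smooth_on U f" "p \<in> U"
  shows "f differentiable (at p)"
proof -
  have "Ck_on (Suc 0) U f" using assms(1) unfolding smooth_on_def by blast
  then show ?thesis using assms(2) by simp
qed

lemma smooth_on_real_DERIV:
  fixes f :: "real \<Rightarrow> real"
  assumes "smooth_on I f" "x \<in> I"
  shows "(f has_real_derivative deriv f x) (at x)"
  using smooth_on_imp_differentiable[OF assms] field_differentiable_derivI[of f x]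
    real_differentiable_def[of f] field_differentiable_def[of f "at x"] by auto

lemma Ck_on_Suc_realI:
  fixes f :: "real \<Rightarrow> real"
  assumes "open I" "\<And>x. x \<in> I \<Longrightarrow> (f has_real_derivative f' x) (at x)" "Ck_on k I f'"
  shows "Ck_on (Suc k) I f"
proof (rule Ck_on_SucI[OF assms(1)])
  show "(f has_derivative (\<lambda>v. f' x * v)) (at x)" if "x \<in> I" for x
    using assms(2)[OF that] by (simp add: has_field_derivative_def)
  show "Ck_on k I (\<lambda>x. f' x * v)" for v
    by (rule Ck_on_mult[OF assms(1,3) Ck_on_const])
qed

text \<open>A derivative of class k makes \<open>f\<close> of class k + 1, so antiderivatives
  inherit smoothness. This serves functions known only through their derivatives, such as
  \<open>F\<close> and \<open>K\<close> below.\<close>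

lemma smooth_on_realI:
  fixes f :: "real \<Rightarrow> real"
  assumes "open I" "\<And>x. x \<in> I \<Longrightarrow> (f has_real_derivative f' x) (at x)" "smooth_on I f'"
  shows "smooth_on I f"
  unfolding smooth_on_def
  using Ck_on_Suc_imp[OF Ck_on_Suc_realI[OF assms(1,2)]] assms(3) by (auto simp: smooth_on_def)

lemma smooth_on_deriv:
  fixes f :: "real \<Rightarrow> real"
  assumes "open I" "smooth_on I f"
  shows "smooth_on I (deriv f)"
proof -
  have "Ck_on k I (deriv f)" for k
  proof -
    have "Ck_on (Suc k) I f" using assms(2) unfolding smooth_on_def by blast
    then have "Ck_on k I (\<lambda>x. frechet_derivative f (at x) 1)" by simp
    moreover have "frechet_derivative f (at x) 1 = deriv f x" if "x \<in> I" for x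
      using frechet_derivative_at[of f "\<lambda>v. deriv f x * v" x] smooth_on_real_DERIV[OF assms(2) that]
      by (metis has_field_derivative_def mult.right_neutral)
    ultimately show ?thesis by (rule Ck_on_cong[OF assms(1), rotated])
  qed
  then show ?thesis by (simp add: smooth_on_def)
qed

text \<open>The derivative - f' (1/f)^2 contains 1/f only undifferentiated, so class k of 1/f gives
  class k + 1.\<close>

lemma smooth_on_inverse:
  fixes f :: "real \<Rightarrow> real"
  assumes "open I" "smooth_on I f" "\<And>x. x \<in> I \<Longrightarrow> f x \<noteq> 0"
  shows "smooth_on I (\<lambda>x. inverse (f x))"
proof -
  have "Ck_on k I (\<lambda>x. inverse (f x))" for k
  proof (induction k)
    case 0
    have "Ck_on 0 I f" using assms(2) unfolding smooth_on_def by blast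
    then show ?case using assms(3) by (auto intro!: continuous_intros)
  next
    case (Suc k)
    have "((\<lambda>x. inverse (f x)) has_real_derivative (- 1 * deriv f x) * (inverse (f x) * inverse (f x))) (at x)"
      if "x \<in> I" for x
      using smooth_on_real_DERIV[OF assms(2) that] assms(3)[OF that]
      by (auto intro!: derivative_eq_intros simp: field_simps power2_eq_square)
    moreover have "Ck_on k I (\<lambda>x. (- 1 * deriv f x) * (inverse (f x) * inverse (f x)))"
      using smooth_on_deriv[OF assms(1,2)]
      by (intro Ck_on_mult[OF assms(1)] Suc Ck_on_const) (simp add: smooth_on_def)
    ultimately show ?case by (rule Ck_on_Suc_realI[OF assms(1)])
  qed
  then show ?thesis by (simp add: smooth_on_def)
qed

lemma smooth_on_vecI:
  fixes X :: "'a::euclidean_space \<Rightarrow> real ^ 'n"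
  assumes "open U" "\<And>i. smooth_on U (\<lambda>p. X p $ i)"
  shows "smooth_on U X"
proof -
  have "Ck_on k U (\<lambda>p. \<Sum>i\<in>A. X p $ i *\<^sub>R (axis i 1 :: real ^ 'n))" if "finite A" for A k
    using that
  proof (induction A)
    case (insert i A)
    have "Ck_on k U (\<lambda>p. X p $ i *\<^sub>R (axis i 1 :: real ^ 'n))"
      using assms(2) by (intro Ck_on_linear[OF assms(1) bounded_linear_scaleR_left]) (simp add: smooth_on_def)
    from Ck_on_lincomb[OF assms(1) this insert(3), of 1 1] insert(1,2) show ?case by simp
  qed (simp add: Ck_on_zero)
  from this[of UNIV] have "smooth_on U (\<lambda>p. \<Sum>i\<in>UNIV. X p $ i *\<^sub>R (axis i 1 :: real ^ 'n))"
    by (simp add: smooth_on_def)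
  moreover have "(\<Sum>i\<in>UNIV. X p $ i *\<^sub>R (axis i 1 :: real ^ 'n)) = X p" for p
    using basis_expansion[of "X p"] by (simp add: scalar_mult_eq_scaleR)
  ultimately show ?thesis by (simp only:)
qed

text \<open>Bootstrapping: the derivatives of \<open>W\<close> and \<open>b\<close> are affine in
  \<open>b\<close> and \<open>W\<close>, so both functions gain an order of differentiability
  together.\<close>

lemma smooth_on_second_order_ode:
  fixes W b :: "real \<Rightarrow> real"
  assumes W: "\<And>y. (W has_real_derivative b y) (at y)" and b: "\<And>y. (b has_real_derivative k * W y + e) (at y)"
  shows "smooth_on UNIV W" "smooth_on UNIV b"
proof -
  have "Ck_on n UNIV W \<and> Ck_on n UNIV b" for n
  proof (induction n)
    case 0
    show ?case
      using DERIV_continuous_on[of UNIV W b] DERIV_continuous_on[of UNIV b "\<lambda>y. k * W y + e"] W b by simp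
  next
    case (Suc n)
    then have "Ck_on n UNIV (\<lambda>y. k * W y + e)"
      using Ck_on_lincomb[of UNIV n W "\<lambda>y. e" k 1] Ck_on_const by auto
    then show ?case using Suc Ck_on_Suc_realI[OF _ W] Ck_on_Suc_realI[OF _ b] by blast
  qed
  then show "smooth_on UNIV W" "smooth_on UNIV b" by (simp_all add: smooth_on_def)
qed

subsection \<open>Calculus on intervals\<close>

lemma interval_zero_deriv_imp_eq:
  fixes f :: "real \<Rightarrow> real"
  assumes "is_interval I" "\<And>x. x \<in> I \<Longrightarrow> (f has_real_derivative 0) (at x)" "x \<in> I" "y \<in> I"
  shows "f x = f y"
proof -
  have "\<exists>c. \<forall>x\<in>I. f x = c"
    using assms(1,2) has_field_derivative_zero_constant[of I f]
    by (auto simp: is_interval_convex_1 intro: DERIV_subset)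
  then show ?thesis using assms(3,4) by auto
qed

lemma open_interval_antiderivative:
  fixes f :: "real \<Rightarrow> real"
  assumes "open I" "is_interval I" "x0 \<in> I" "continuous_on I f"
  obtains F where "F x0 = 0" "\<And>x. x \<in> I \<Longrightarrow> (F has_real_derivative f x) (at x)"
proof (rule that[of "\<lambda>x. interval_lebesgue_integral lborel (ereal x0) (ereal x) f"])
  let ?F = "\<lambda>x. interval_lebesgue_integral lborel (ereal x0) (ereal x) f"
  show "?F x0 = 0" by simp
  fix x assume "x \<in> I"
  obtain d where d: "d > 0" "cball x0 d \<subseteq> I"
    using assms(1,3) open_contains_cball by blast
  obtain e where e: "e > 0" "cball x e \<subseteq> I"
    using assms(1) \<open>x \<in> I\<close> open_contains_cball by blast
  \<comment> \<open>Both \<open>x0\<close> and \<open>x\<close> are interior to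
    \<open>{a..b}\<close>, which stays inside \<open>I\<close>; being interior turns the derivative
    within \<open>{a..b}\<close> into a two-sided one.\<close>
  define a b where "a = min (x0 - d) (x - e)" and "b = max (x0 + d) (x + e)"
  have "x0 - d \<in> I" "x0 + d \<in> I" "x - e \<in> I" "x + e \<in> I"
    using d e by (auto simp: subset_iff dist_real_def)
  then have "a \<in> I" "b \<in> I" by (auto simp: a_def b_def min_def max_def)
  then have sub: "{a..b} \<subseteq> I"
    using assms(2) unfolding is_interval_1 by (meson atLeastAtMost_iff subsetI)
  have lt: "a < x0" "x0 < b" "a < x" "x < b"
    using d e by (auto simp: a_def b_def)
  have "(?F has_vector_derivative f x) (at x within {a..b})"
    using lt by (intro interval_integral_FTC2 continuous_on_subset[OF assms(4) sub]) auto
  then show "(?F has_real_derivative f x) (at x)"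
    using lt by (simp add: has_real_derivative_iff_has_vector_derivative at_within_Icc_at)
qed

text \<open>Sine, cosine and the integral of sine for curvature -k: trigonometric, polynomial or
  hyperbolic according to the sign of \<open>k\<close>. Carrying \<open>w\<close>, which is (c -
  1)/k for nonzero \<open>k\<close> and u^2/2 for \<open>k\<close> = 0, lets the later argument
  avoid any case distinction on \<open>k\<close>.\<close>

lemma constant_curvature_trig:
  fixes k :: real
  obtains s c w :: "real \<Rightarrow> real" where "s 0 = 0" "c 0 = 1" "w 0 = 0"
    and "\<And>u. (s has_real_derivative c u) (at u)" "\<And>u. (c has_real_derivative k * s u) (at u)"
    and "\<And>u. (w has_real_derivative s u) (at u)" "\<And>u. c u = k * w u + 1"
proof (cases k "0 :: real" rule: linorder_cases)
  case less
  define r where "r = sqrt (- k)"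
  have r: "r > 0" "k = - r\<^sup>2" using less by (auto simp: r_def)
  show thesis
    by (rule that[of "\<lambda>u. sin (r * u) / r" "\<lambda>u. cos (r * u)" "\<lambda>u. (1 - cos (r * u)) / r\<^sup>2"])
      (use r(1) in \<open>auto intro!: derivative_eq_intros simp: r(2) field_simps power2_eq_square\<close>)
next
  case equal
  show thesis
    by (rule that[of "\<lambda>u. u" "\<lambda>u. 1" "\<lambda>u. u\<^sup>2 / 2"])
      (auto intro!: derivative_eq_intros simp: equal)
next
  case greater
  define r where "r = sqrt k"
  have r: "r > 0" "k = r\<^sup>2" using greater by (auto simp: r_def)
  show thesis
    by (rule that[of "\<lambda>u. sinh (r * u) / r" "\<lambda>u. cosh (r * u)" "\<lambda>u. (cosh (r * u) - 1) / r\<^sup>2"])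
      (use r(1) in \<open>auto intro!: derivative_eq_intros simp: r(2) field_simps power2_eq_square\<close>)
qed

text \<open>The quantities b c - b' s and b' c - k b s are first integrals of b'' = k b and vanish
  at \<open>y0\<close>. Together with the Pythagorean identity c^2 - k s^2 = 1 they force b =
  0.\<close>

lemma linear_oscillator_zero:
  fixes b b' :: "real \<Rightarrow> real"
  assumes b: "\<And>y. (b has_real_derivative b' y) (at y)" "\<And>y. (b' has_real_derivative k * b y) (at y)"
    and 0: "b y0 = 0" "b' y0 = 0"
  shows "b y = 0"
proof -
  obtain s c w :: "real \<Rightarrow> real" where sc: "s 0 = 0" "c 0 = 1"
    "\<And>u. (s has_real_derivative c u) (at u)" "\<And>u. (c has_real_derivative k * s u) (at u)"
    using constant_curvature_trig[of k] by metis
  have const: "f y = f y0" if "\<And>y. (f has_real_derivative 0) (at y)" for f :: "real \<Rightarrow> real"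
    using interval_zero_deriv_imp_eq[of UNIV f] that by auto
  have "b y * c y - b' y * s y = b y0 * c y0 - b' y0 * s y0"
    by (rule const) (auto intro!: derivative_eq_intros b sc simp: algebra_simps)
  moreover have "b' y * c y - k * b y * s y = b' y0 * c y0 - k * b y0 * s y0"
    by (rule const) (auto intro!: derivative_eq_intros b sc simp: algebra_simps)
  ultimately have 1: "b y * c y = b' y * s y" "b' y * c y = k * b y * s y"
    using 0 by simp_all
  have "(c y)\<^sup>2 - k * (s y)\<^sup>2 = (c 0)\<^sup>2 - k * (s 0)\<^sup>2"
    by (rule interval_zero_deriv_imp_eq[of UNIV]) (auto intro!: derivative_eq_intros sc)
  then have "b y = b y * ((c y)\<^sup>2 - k * (s y)\<^sup>2)" by (simp add: sc)
  also have "\<dots> = (b y * c y) * c y - k * b y * (s y)\<^sup>2" by (simp add: algebra_simps power2_eq_square)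
  also have "\<dots> = (b' y * c y) * s y - k * b y * (s y)\<^sup>2" by (simp add: 1(1) ac_simps)
  also have "\<dots> = 0" by (simp add: 1(2) power2_eq_square)
  finally show ?thesis .
qed

text \<open>If S S' vanished everywhere, S^2 would be constant. Then either S is identically zero or
  it has no zero, and in the latter case S' = 0 throughout; both make S constant.\<close>

lemma nonconstant_imp_deriv_square_nonzero:
  fixes S :: "real \<Rightarrow> real"
  assumes "is_interval J" "\<And>z. z \<in> J \<Longrightarrow> (S has_real_derivative S' z) (at z)" "\<not> S constant_on J"
  obtains z where "z \<in> J" "S z \<noteq> 0" "S' z \<noteq> 0"
proof (rule ccontr)
  assume "\<not> thesis"
  with that have z: "S z * S' z = 0" if "z \<in> J" for z using \<open>z \<in> J\<close> by auto
  have sq: "(S u)\<^sup>2 = (S v)\<^sup>2" if "u \<in> J" "v \<in> J" for u v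
  proof (rule interval_zero_deriv_imp_eq[OF assms(1) _ that])
    show "((\<lambda>z. (S z)\<^sup>2) has_real_derivative 0) (at z)" if "z \<in> J" for z
      using assms(2)[OF that] z[OF that] by (auto intro!: derivative_eq_intros)
  qed
  have "S u = S v" if uv: "u \<in> J" "v \<in> J" for u v
  proof (cases "S u = 0")
    case True
    then show ?thesis using sq[OF uv] by simp
  next
    case False
    have "(S has_real_derivative 0) (at x)" if "x \<in> J" for x
      using sq[OF uv(1) that] False z[OF that] assms(2)[OF that] by auto
    from interval_zero_deriv_imp_eq[OF assms(1) this uv] show ?thesis .
  qed
  then have "S constant_on J" unfolding constant_on_def by metis
  with assms(3) show False by simp
qed

subsection \<open>Coordinates and partial derivatives\<close>

lemma four_eq_zero: "(4 :: 4) = 0"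
  by simp

lemma sum_4_from_0: "sum f (UNIV :: 4 set) = f 0 + f 1 + f 2 + f 3"
  by (simp add: sum_4 four_eq_zero ac_simps)

lemma forall_4_from_0: "(\<forall>i::4. P i) \<longleftrightarrow> P 0 \<and> P 1 \<and> P 2 \<and> P 3"
  by (auto simp: forall_4 four_eq_zero)

definition pt :: "real \<Rightarrow> real \<Rightarrow> real \<Rightarrow> real \<Rightarrow> point" where
  "pt t x y z = (\<chi> i. if i = 0 then t else if i = 1 then x else if i = 2 then y else z)"

lemma pt_nth [simp]: "pt t x y z $ 0 = t" "pt t x y z $ 1 = x" "pt t x y z $ 2 = y" "pt t x y z $ 3 = z"
  by (simp_all add: pt_def)

lemma vec4_eq_iff: "(p :: point) = q \<longleftrightarrow> p $ 0 = q $ 0 \<and> p $ 1 = q $ 1 \<and> p $ 2 = q $ 2 \<and> p $ 3 = q $ 3"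
  by (simp add: vec_eq_iff forall_4_from_0)

lemma pt_eta [simp]: "pt (p $ 0) (p $ 1) (p $ 2) (p $ 3) = p"
  by (simp add: vec4_eq_iff)

lemma pderiv_eqI: "(f has_derivative f') (at p) \<Longrightarrow> pderiv i f p = f' (axis i 1)"
  using frechet_derivative_at[of f f' p] by (simp add: pderiv_def)

lemma pderiv_cong:
  assumes "open U" "p \<in> U" "f differentiable (at p)" "\<And>q. q \<in> U \<Longrightarrow> f q = f' q"
  shows "pderiv i f' p = pderiv i f p"
  using frechet_derivative_transform_within_open[OF assms(3,1,2,4)] by (simp add: pderiv_def)

lemma DERIV_along_axis:
  assumes "f differentiable (at (q + s0 *\<^sub>R axis i 1))"
  shows "((\<lambda>s. f (q + s *\<^sub>R axis i 1)) has_real_derivative pderiv i f (q + s0 *\<^sub>R axis i 1)) (at s0)"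
proof -
  let ?p = "q + s0 *\<^sub>R axis i (1::real)" and ?L = "\<lambda>s. q + s *\<^sub>R axis i (1::real)"
  have "(f has_derivative frechet_derivative f (at ?p)) (at (?L s0))"
    using assms by (simp add: frechet_derivative_works)
  moreover have "(?L has_derivative (\<lambda>h. h *\<^sub>R axis i 1)) (at s0)"
    by (auto intro!: derivative_eq_intros)
  ultimately have "((\<lambda>s. f (?L s)) has_derivative (\<lambda>h. frechet_derivative f (at ?p) (h *\<^sub>R axis i 1))) (at s0)"
    by (rule has_derivative_compose[rotated])
  moreover have "frechet_derivative f (at ?p) (h *\<^sub>R axis i 1) = pderiv i f ?p * h" for h
    using linear_scale[OF linear_frechet_derivative[OF assms], of h "axis i 1"]
    by (simp add: pderiv_def)
  ultimately show ?thesis by (simp add: has_field_derivative_def)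
qed

lemma DERIV_pt:
  assumes "f differentiable (at (pt t x y z))"
  shows "((\<lambda>t. f (pt t x y z)) has_real_derivative pderiv 0 f (pt t x y z)) (at t)"
    and "((\<lambda>x. f (pt t x y z)) has_real_derivative pderiv 1 f (pt t x y z)) (at x)"
    and "((\<lambda>y. f (pt t x y z)) has_real_derivative pderiv 2 f (pt t x y z)) (at y)"
    and "((\<lambda>z. f (pt t x y z)) has_real_derivative pderiv 3 f (pt t x y z)) (at z)"
proof -
  have eq: "pt 0 x y z + s *\<^sub>R axis 0 1 = pt s x y z" "pt t 0 y z + s *\<^sub>R axis 1 1 = pt t s y z"
    "pt t x 0 z + s *\<^sub>R axis 2 1 = pt t x s z" "pt t x y 0 + s *\<^sub>R axis 3 1 = pt t x y s" for s
    by (simp_all add: vec4_eq_iff axis_def)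
  show "((\<lambda>t. f (pt t x y z)) has_real_derivative pderiv 0 f (pt t x y z)) (at t)"
    using DERIV_along_axis[of f "pt 0 x y z" t 0] assms unfolding eq .
  show "((\<lambda>x. f (pt t x y z)) has_real_derivative pderiv 1 f (pt t x y z)) (at x)"
    using DERIV_along_axis[of f "pt t 0 y z" x 1] assms unfolding eq .
  show "((\<lambda>y. f (pt t x y z)) has_real_derivative pderiv 2 f (pt t x y z)) (at y)"
    using DERIV_along_axis[of f "pt t x 0 z" y 2] assms unfolding eq .
  show "((\<lambda>z. f (pt t x y z)) has_real_derivative pderiv 3 f (pt t x y z)) (at z)"
    using DERIV_along_axis[of f "pt t x y 0" z 3] assms unfolding eq .
qed

subsection \<open>The Lie equations\<close>

text \<open>The domain is the product R x I x R x J, so each coordinate line meets \<open>U\<close>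
  in an interval and equations can be integrated one coordinate at a time.\<close>

locale goedel_type_torsion =
  fixes I J :: "real set" and H D S :: "real \<Rightarrow> real" and \<omega> m2 :: real
    and U :: "point set" and g :: tensor2 and \<Gamma> :: tensor3
  assumes open_I: "open I" and interval_I: "is_interval I"
    and open_J: "open J" and interval_J: "is_interval J"
    and U_def: "U = {p. p $ 1 \<in> I \<and> p $ 3 \<in> J}"
    and smooth_H: "smooth_on I H" and smooth_D: "smooth_on I D" and smooth_S: "smooth_on J S"
    and D_nonzero: "x \<in> I \<Longrightarrow> D x \<noteq> 0"
    and metric_sym: "p \<in> U \<Longrightarrow> g p a b = g p b a"
    and line_element: "p \<in> U \<Longrightarrow> metric_prod g p v v =
           (v $ 0 + H (p $ 1) * v $ 2)\<^sup>2 - (D (p $ 1))\<^sup>2 * (v $ 2)\<^sup>2 - (v $ 1)\<^sup>2 - (v $ 3)\<^sup>2"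
    and torsion_components: "p \<in> U \<Longrightarrow> torsion \<Gamma> p a b c =
           (if a = 0 \<and> b = 1 \<and> c = 2 then D (p $ 1) * S (p $ 3)
            else if a = 0 \<and> b = 2 \<and> c = 1 then - (D (p $ 1) * S (p $ 3))
            else 0)"
    and deriv_H: "x \<in> I \<Longrightarrow> deriv H x / D x = 2 * \<omega>"
    and deriv_deriv_D: "x \<in> I \<Longrightarrow> deriv (deriv D) x / D x = m2"
    and S_nonconstant: "\<not> S constant_on J"
begin

abbreviation \<A> :: "vfield set" where "\<A> \<equiv> affine_isometry_algebra U g \<Gamma>"

lemma open_U: "open U"
proof -
  have "open ((\<lambda>p :: point. p $ 1) -` I \<inter> (\<lambda>p. p $ 3) -` J)"
    by (intro open_Int open_vimage open_I open_J continuous_intros)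
  then show ?thesis by (simp add: U_def vimage_def Collect_conj_eq)
qed

lemma pt_in_U [simp]: "pt t x y z \<in> U \<longleftrightarrow> x \<in> I \<and> z \<in> J"
  by (simp add: U_def)

lemma nth_in_U: "p \<in> U \<Longrightarrow> p $ 1 \<in> I" "p \<in> U \<Longrightarrow> p $ 3 \<in> J"
  by (simp_all add: U_def)

lemma DERIV_H: "x \<in> I \<Longrightarrow> (H has_real_derivative 2 * \<omega> * D x) (at x)"
  using smooth_on_real_DERIV[OF smooth_H, of x] deriv_H[of x] D_nonzero[of x]
  by (auto simp: divide_eq_eq)

lemma DERIV_D: "x \<in> I \<Longrightarrow> (D has_real_derivative deriv D x) (at x)"
  by (rule smooth_on_real_DERIV[OF smooth_D])

lemma DERIV_deriv_D: "x \<in> I \<Longrightarrow> (deriv D has_real_derivative m2 * D x) (at x)"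
  using smooth_on_real_DERIV[OF smooth_on_deriv[OF open_I smooth_D], of x] deriv_deriv_D[of x] D_nonzero[of x]
  by (auto simp: divide_eq_eq)

lemma DERIV_S: "z \<in> J \<Longrightarrow> (S has_real_derivative deriv S z) (at z)"
  by (rule smooth_on_real_DERIV[OF smooth_S])

text \<open>One computation for all explicit coefficients: the metric (with \<psi> = 1), the torsion
  D(x) S(z), and the components of the motions, which are affine in a function of y with
  coefficients depending on x.\<close>

lemma pderiv_separated:
  assumes "p \<in> U" "j \<noteq> 1" "(\<phi> has_real_derivative \<phi>') (at (p $ 1))"
    and "(\<psi> has_real_derivative \<psi>') (at (p $ j))" "(\<theta> has_real_derivative \<theta>') (at (p $ 1))"
    and "\<And>q. q \<in> U \<Longrightarrow> f q = \<phi> (q $ 1) * \<psi> (q $ j) + \<theta> (q $ 1)"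
  shows "pderiv i f p =
    (if i = 1 then \<phi>' * \<psi> (p $ j) + \<theta>' else if i = j then \<phi> (p $ 1) * \<psi>' else 0)"
proof -
  have "((\<lambda>q. \<phi> (q $ 1) * \<psi> (q $ j) + \<theta> (q $ 1)) has_derivative
      (\<lambda>v. (\<phi> (p $ 1) * (v $ j * \<psi>') + (v $ 1 * \<phi>') * \<psi> (p $ j)) + v $ 1 * \<theta>')) (at p)"
    by (intro has_derivative_add has_derivative_mult
        DERIV_compose_FDERIV[where g = "\<lambda>q. q $ 1", OF assms(3)]
        DERIV_compose_FDERIV[where g = "\<lambda>q. q $ j", OF assms(4)]
        DERIV_compose_FDERIV[where g = "\<lambda>q. q $ 1", OF assms(5)]
        bounded_linear_imp_has_derivative bounded_linear_vec_nth)
  moreover from this have "pderiv i f p = pderiv i (\<lambda>q. \<phi> (q $ 1) * \<psi> (q $ j) + \<theta> (q $ 1)) p"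
    using assms(6) by (intro pderiv_cong[OF open_U assms(1)]) (auto simp: differentiable_def)
  ultimately show ?thesis
    using assms(2) by (auto simp: pderiv_eqI axis_def)
qed

definition metric_coeff :: "real \<Rightarrow> 4 \<Rightarrow> 4 \<Rightarrow> real" where
  "metric_coeff x a b =
    (if a = 0 \<and> b = 0 then 1
     else if a = 0 \<and> b = 2 \<or> a = 2 \<and> b = 0 then H x
     else if a = 2 \<and> b = 2 then (H x)\<^sup>2 - (D x)\<^sup>2
     else if a = b then - 1 else 0)"

text \<open>The x-derivative of \<open>metric_coeff\<close>, with H' already replaced by 2 \<omega>
  D.\<close>

definition metric_coeff' :: "real \<Rightarrow> 4 \<Rightarrow> 4 \<Rightarrow> real" where
  "metric_coeff' x a b =
    (if a = 0 \<and> b = 2 \<or> a = 2 \<and> b = 0 then 2 * \<omega> * D x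
     else if a = 2 \<and> b = 2 then 4 * \<omega> * H x * D x - 2 * D x * deriv D x
     else 0)"

text \<open>Polarisation: unit vectors give the diagonal entries of the quadratic form; sums of two
  unit vectors, with the symmetry of \<open>g\<close>, give the others.\<close>

lemma metric_eq:
  assumes "p \<in> U"
  shows "g p a b = metric_coeff (p $ 1) a b"
proof -
  let ?Q = "\<lambda>v. metric_prod g p v v"
  have diag: "g p 0 0 = 1" "g p 1 1 = - 1" "g p 2 2 = (H (p $ 1))\<^sup>2 - (D (p $ 1))\<^sup>2" "g p 3 3 = - 1"
    using line_element[OF assms, of "pt 1 0 0 0"] line_element[OF assms, of "pt 0 1 0 0"]
      line_element[OF assms, of "pt 0 0 1 0"] line_element[OF assms, of "pt 0 0 0 1"]
    by (simp_all add: metric_prod_def sum_4_from_0)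
  have off: "g p 0 1 = 0" "g p 0 2 = H (p $ 1)" "g p 0 3 = 0" "g p 1 2 = 0" "g p 1 3 = 0" "g p 2 3 = 0"
    using line_element[OF assms, of "pt 1 1 0 0"] line_element[OF assms, of "pt 1 0 1 0"]
      line_element[OF assms, of "pt 1 0 0 1"] line_element[OF assms, of "pt 0 1 1 0"]
      line_element[OF assms, of "pt 0 1 0 1"] line_element[OF assms, of "pt 0 0 1 1"]
      metric_sym[OF assms, of 1 0] metric_sym[OF assms, of 2 0] metric_sym[OF assms, of 3 0]
      metric_sym[OF assms, of 2 1] metric_sym[OF assms, of 3 1] metric_sym[OF assms, of 3 2]
    by (simp_all add: metric_prod_def sum_4_from_0 diag power2_sum)
  have "\<forall>a b. g p a b = metric_coeff (p $ 1) a b"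
    using diag off metric_sym[OF assms, of 1 0] metric_sym[OF assms, of 2 0] metric_sym[OF assms, of 3 0]
      metric_sym[OF assms, of 2 1] metric_sym[OF assms, of 3 1] metric_sym[OF assms, of 3 2]
    by (simp add: forall_4_from_0 metric_coeff_def)
  then show ?thesis by blast
qed

lemma pderiv_metric:
  assumes "p \<in> U"
  shows "pderiv c (\<lambda>q. g q a b) p = (if c = 1 then metric_coeff' (p $ 1) a b else 0)"
proof -
  note [derivative_intros] = DERIV_H[OF nth_in_U(1)[OF assms]] DERIV_D[OF nth_in_U(1)[OF assms]]
  have "\<forall>a b. ((\<lambda>x. metric_coeff x a b) has_real_derivative metric_coeff' (p $ 1) a b) (at (p $ 1))"
    by (auto intro!: derivative_eq_intros simp: forall_4_from_0 metric_coeff_def metric_coeff'_def)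
  then have "((\<lambda>x. metric_coeff x a b) has_real_derivative metric_coeff' (p $ 1) a b) (at (p $ 1))"
    by blast
  from pderiv_separated[OF assms _ this DERIV_const[of 1] DERIV_const[of 0], of 3 "\<lambda>q. g q a b" c]
  show ?thesis by (simp add: metric_eq)
qed

text \<open>The ten Killing equations in the order tt, tx, ty, tz, xx, xy, xz, yy, yz, zz, up to
  constant factors. \<open>P i a\<close> is the derivative of the component a of X in direction
  i.\<close>

lemma lie_metric_zero_iff:
  fixes X :: vfield
  assumes "p \<in> U"
  defines "P \<equiv> \<lambda>i a. pderiv i (\<lambda>q. X q $ a) p" and "h \<equiv> H (p $ 1)" and "d \<equiv> D (p $ 1)"
  shows "(\<forall>a b. lie_metric X g p a b = 0) \<longleftrightarrow>
    P 0 0 + h * P 0 2 = 0 \<and>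
    P 1 0 + h * P 1 2 - P 0 1 = 0 \<and>
    2 * \<omega> * d * X p $ 1 + h * P 0 0 + (h\<^sup>2 - d\<^sup>2) * P 0 2 + P 2 0 + h * P 2 2 = 0 \<and>
    P 3 0 + h * P 3 2 - P 0 3 = 0 \<and>
    P 1 1 = 0 \<and>
    h * P 1 0 + (h\<^sup>2 - d\<^sup>2) * P 1 2 - P 2 1 = 0 \<and>
    P 3 1 + P 1 3 = 0 \<and>
    (2 * \<omega> * h * d - d * deriv D (p $ 1)) * X p $ 1 + h * P 2 0 + (h\<^sup>2 - d\<^sup>2) * P 2 2 = 0 \<and>
    h * P 3 0 + (h\<^sup>2 - d\<^sup>2) * P 3 2 - P 2 3 = 0 \<and>
    P 3 3 = 0"
proof -
  have P: "pderiv i (\<lambda>q. X q $ a) p = P i a" for i a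
    by (simp add: P_def)
  show ?thesis
    unfolding lie_metric_def forall_4_from_0 sum_4_from_0 metric_eq[OF assms(1)] pderiv_metric[OF assms(1)]
      metric_coeff_def metric_coeff'_def P h_def[symmetric] d_def[symmetric]
    by (simp add: algebra_simps) argo
qed

text \<open>The first equation is the component (t; x, y). Components with another upper index
  remove the t-derivatives of the spatial components; upper index t with a lower index z removes the
  z-derivatives of X^x and X^y.\<close>

lemma lie_torsion_zero_iff:
  fixes X :: vfield
  assumes "p \<in> U"
  defines "P \<equiv> \<lambda>i a. pderiv i (\<lambda>q. X q $ a) p" and "d \<equiv> D (p $ 1)" and "s \<equiv> S (p $ 3)"
  shows "(\<forall>a b c. lie_torsion X (torsion \<Gamma>) p a b c = 0) \<longleftrightarrow>
    X p $ 1 * deriv D (p $ 1) * s + X p $ 3 * d * deriv S (p $ 3)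
      + d * s * (P 1 1 + P 2 2 - P 0 0) = 0 \<and>
    d * s * P 0 1 = 0 \<and> d * s * P 0 2 = 0 \<and> d * s * P 0 3 = 0 \<and>
    d * s * P 3 1 = 0 \<and> d * s * P 3 2 = 0"
proof -
  \<comment> \<open>The constant sign pattern of the torsion; with it every component has the
    separated form required by \<open>pderiv_separated\<close>.\<close>
  define \<epsilon> :: "4 \<Rightarrow> 4 \<Rightarrow> 4 \<Rightarrow> real" where
    "\<epsilon> a b c = (if a = 0 \<and> b = 1 \<and> c = 2 then 1 else if a = 0 \<and> b = 2 \<and> c = 1 then - 1 else 0)" for a b c
  have eq: "torsion \<Gamma> q a b c = (\<epsilon> a b c * D (q $ 1)) * S (q $ 3)" if "q \<in> U" for q a b c
    using torsion_components[OF that] by (simp add: \<epsilon>_def)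
  have d: "pderiv i (\<lambda>q. torsion \<Gamma> q a b c) p =
      (if i = 1 then \<epsilon> a b c * deriv D (p $ 1) * s else if i = 3 then \<epsilon> a b c * d * deriv S (p $ 3) else 0)"
    for i a b c
    unfolding d_def s_def
    using pderiv_separated[OF assms(1) _ DERIV_cmult[OF DERIV_D[OF nth_in_U(1)[OF assms(1)]]]
        DERIV_S[OF nth_in_U(2)[OF assms(1)]] DERIV_const[of 0],
        of "\<lambda>q. torsion \<Gamma> q a b c" "\<epsilon> a b c" i]
    by (simp add: eq)
  have P: "pderiv i (\<lambda>q. X q $ a) p = P i a" for i a
    by (simp add: P_def)
  show ?thesis
    unfolding lie_torsion_def forall_4_from_0 sum_4_from_0 d eq[OF assms(1)] \<epsilon>_def P s_def[symmetric] d_def[symmetric]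
    by (simp add: algebra_simps) argo
qed

section \<open>Solving the Lie equations for the first derivatives of a motion\<close>

lemma pderiv_zero_imp_indep:
  assumes f: "\<And>p. p \<in> U \<Longrightarrow> f differentiable (at p)"
  shows "(\<And>p. p \<in> U \<Longrightarrow> pderiv 0 f p = 0) \<Longrightarrow> x \<in> I \<Longrightarrow> z \<in> J \<Longrightarrow> f (pt t x y z) = f (pt t' x y z)"
    and "(\<And>p. p \<in> U \<Longrightarrow> pderiv 1 f p = 0) \<Longrightarrow> x \<in> I \<Longrightarrow> x' \<in> I \<Longrightarrow> z \<in> J \<Longrightarrow> f (pt t x y z) = f (pt t x' y z)"
    and "(\<And>p. p \<in> U \<Longrightarrow> pderiv 2 f p = 0) \<Longrightarrow> x \<in> I \<Longrightarrow> z \<in> J \<Longrightarrow> f (pt t x y z) = f (pt t x y' z)"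
    and "(\<And>p. p \<in> U \<Longrightarrow> pderiv 3 f p = 0) \<Longrightarrow> x \<in> I \<Longrightarrow> z \<in> J \<Longrightarrow> z' \<in> J \<Longrightarrow> f (pt t x y z) = f (pt t x y z')"
proof -
  assume *: "\<And>p. p \<in> U \<Longrightarrow> pderiv 0 f p = 0" "x \<in> I" "z \<in> J"
  show "f (pt t x y z) = f (pt t' x y z)"
    by (rule interval_zero_deriv_imp_eq[of UNIV "\<lambda>t. f (pt t x y z)"])
      (use DERIV_pt(1)[OF f] * in auto)
next
  assume *: "\<And>p. p \<in> U \<Longrightarrow> pderiv 1 f p = 0" "x \<in> I" "x' \<in> I" "z \<in> J"
  show "f (pt t x y z) = f (pt t x' y z)"
    by (rule interval_zero_deriv_imp_eq[OF interval_I, of "\<lambda>x. f (pt t x y z)"])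
      (use DERIV_pt(2)[OF f, of t _ y z] * in auto)
next
  assume *: "\<And>p. p \<in> U \<Longrightarrow> pderiv 2 f p = 0" "x \<in> I" "z \<in> J"
  show "f (pt t x y z) = f (pt t x y' z)"
    by (rule interval_zero_deriv_imp_eq[of UNIV "\<lambda>y. f (pt t x y z)"])
      (use DERIV_pt(3)[OF f] * in auto)
next
  assume *: "\<And>p. p \<in> U \<Longrightarrow> pderiv 3 f p = 0" "x \<in> I" "z \<in> J" "z' \<in> J"
  show "f (pt t x y z) = f (pt t x y z')"
    by (rule interval_zero_deriv_imp_eq[OF interval_J, of "\<lambda>z. f (pt t x y z)"])
      (use DERIV_pt(4)[OF f, of t x y] * in auto)
qed

lemma pderiv_zero_on_U:
  assumes "\<And>q. q \<in> U \<Longrightarrow> f q = 0" "p \<in> U"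
  shows "pderiv i f p = 0"
  using pderiv_cong[OF open_U assms(2), of "\<lambda>q. 0" f i] assms(1)
  by (simp add: pderiv_def)

lemma algebra_component_differentiable:
  "X \<in> \<A> \<Longrightarrow> p \<in> U \<Longrightarrow> (\<lambda>q. X q $ i) differentiable (at p)"
  by (auto simp: affine_isometry_algebra_def intro: smooth_on_component_differentiable)

lemma algebra_z_component_zero:
  assumes "X \<in> \<A>" "p \<in> U"
  shows "X p $ 3 = 0"
proof -
  \<comment> \<open>On the slice \<open>z = z1\<close> the torsion equation determines \<open>X\<^sup>z S'\<close>; Killing's equation
    \<open>\<partial>\<^sub>z X\<^sup>z = 0\<close> then carries \<open>X\<^sup>z = 0\<close> to all of \<open>U\<close>.\<close>
  obtain z1 where z1: "z1 \<in> J" "S z1 \<noteq> 0" "deriv S z1 \<noteq> 0"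
    using nonconstant_imp_deriv_square_nonzero[OF interval_J DERIV_S S_nonconstant] by blast
  have lie: "\<forall>a b. lie_metric X g q a b = 0" "\<forall>a b c. lie_torsion X (torsion \<Gamma>) q a b c = 0"
    if "q \<in> U" for q
    using assms(1) that by (auto simp: affine_isometry_algebra_def)
  let ?q = "pt (p $ 0) (p $ 1) (p $ 2) z1"
  have q: "?q \<in> U" using nth_in_U[OF assms(2)] z1 by simp
  note M = lie(1)[OF q, unfolded lie_metric_zero_iff[OF q], simplified]
  note T = lie(2)[OF q, unfolded lie_torsion_zero_iff[OF q], simplified]
  let ?P = "\<lambda>i a. pderiv i (\<lambda>q. X q $ a) ?q" and ?x = "p $ 1"
  have D: "D ?x \<noteq> 0" using D_nonzero nth_in_U[OF assms(2)] by simp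
  have P0: "?P 0 1 = 0" "?P 0 2 = 0" using T D z1 by auto
  have P00: "?P 0 0 = 0" and P11: "?P 1 1 = 0" using M P0 by auto
  have P20: "?P 2 0 = - H ?x * ?P 2 2 - 2 * \<omega> * D ?x * X ?q $ 1"
    using M P0 P00 by simp
  have "D ?x * (deriv D ?x * X ?q $ 1 + D ?x * ?P 2 2) = 0"
    using M by (simp add: P20 algebra_simps power2_eq_square)
  then have P22: "deriv D ?x * X ?q $ 1 + D ?x * ?P 2 2 = 0" using D by simp
  \<comment> \<open>The torsion equation repeats the bracket of the yy Killing equation, here
    multiplied by S; only the term with S' survives.\<close>
  have "S z1 * (deriv D ?x * X ?q $ 1 + D ?x * ?P 2 2) + X ?q $ 3 * D ?x * deriv S z1 = 0"
    using T P00 P11 by (simp add: algebra_simps)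
  then have "X ?q $ 3 = 0" using P22 D z1 by simp
  moreover have "X p $ 3 = X ?q $ 3"
    using pderiv_zero_imp_indep(4)[of "\<lambda>q. X q $ 3" "p $ 1" "p $ 3" z1 "p $ 0" "p $ 2"]
      algebra_component_differentiable[OF assms(1)] lie(1) lie_metric_zero_iff nth_in_U[OF assms(2)] z1
    by simp
  ultimately show ?thesis by simp
qed

text \<open>With X^z = 0 the system can be solved for the first derivatives. The only one left free
  is \<open>P 2 1\<close>, the y-derivative of X^x, which later serves as the fourth initial
  datum.\<close>

lemma algebra_equations:
  assumes X: "X \<in> \<A>" and p: "p \<in> U"
  defines "P \<equiv> \<lambda>i a. pderiv i (\<lambda>q. X q $ a) p" and "x \<equiv> p $ 1"
  shows "P 0 a = 0" "P 3 a = 0" "P 1 1 = 0"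
    "P 2 2 = - deriv D x / D x * X p $ 1"
    "P 2 0 = - H x * P 2 2 - 2 * \<omega> * D x * X p $ 1"
    "P 1 2 = - P 2 1 / (D x)\<^sup>2"
    "P 1 0 = - H x * P 1 2"
proof -
  have lie: "\<forall>a b. lie_metric X g q a b = 0" "\<forall>a b c. lie_torsion X (torsion \<Gamma>) q a b c = 0"
    if "q \<in> U" for q
    using X that by (auto simp: affine_isometry_algebra_def)
  have M: "P 0 0 + H x * P 0 2 = 0"
    "P 1 0 + H x * P 1 2 - P 0 1 = 0"
    "2 * \<omega> * D x * X p $ 1 + H x * P 0 0 + ((H x)\<^sup>2 - (D x)\<^sup>2) * P 0 2 + P 2 0 + H x * P 2 2 = 0"
    "P 1 1 = 0"
    "H x * P 1 0 + ((H x)\<^sup>2 - (D x)\<^sup>2) * P 1 2 - P 2 1 = 0"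
    "(2 * \<omega> * H x * D x - D x * deriv D x) * X p $ 1 + H x * P 2 0 + ((H x)\<^sup>2 - (D x)\<^sup>2) * P 2 2 = 0"
    using lie(1)[OF p] unfolding lie_metric_zero_iff[OF p] P_def x_def by blast+
  have D: "D x \<noteq> 0" using D_nonzero nth_in_U[OF p] by (simp add: x_def)
  \<comment> \<open>Killing's equations suffice here: tz and yz form a linear system for
    \<open>?Q 3 0\<close> and \<open>?Q 3 2\<close> with determinant -D^2.\<close>
  have P3: "pderiv 3 (\<lambda>q. X q $ a) q = 0" if q: "q \<in> U" for q a
  proof -
    let ?Q = "\<lambda>i a. pderiv i (\<lambda>q. X q $ a) q" and ?x = "q $ 1"
    have X3: "?Q i 3 = 0" for i
      by (rule pderiv_zero_on_U[OF algebra_z_component_zero[OF X] q])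
    have M3: "?Q 3 0 + H ?x * ?Q 3 2 = 0" "?Q 3 1 = 0"
      "H ?x * ?Q 3 0 + ((H ?x)\<^sup>2 - (D ?x)\<^sup>2) * ?Q 3 2 = 0"
      using lie(1)[OF q] unfolding lie_metric_zero_iff[OF q] X3 by auto
    have "H ?x * (?Q 3 0 + H ?x * ?Q 3 2) - (D ?x)\<^sup>2 * ?Q 3 2 = 0"
      using M3(3) by (simp add: algebra_simps power2_eq_square)
    then have "?Q 3 2 = 0" using M3(1) D_nonzero nth_in_U[OF q] by simp
    then have "\<forall>a. ?Q 3 a = 0" using M3 X3 by (simp add: forall_4_from_0)
    then show ?thesis by blast
  qed
  show "P 3 a = 0" using P3[OF p] by (simp add: P_def)
  show P0: "P 0 a = 0" for a
  proof -
    \<comment> \<open>Where S vanishes, the torsion equations say nothing about t-derivatives. They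
      are therefore evaluated on a slice with S nonzero, and z-independence carries the result back
      to \<open>p\<close>.\<close>
    obtain z1 where z1: "z1 \<in> J" "S z1 \<noteq> 0"
      using nonconstant_imp_deriv_square_nonzero[OF interval_J DERIV_S S_nonconstant] by blast
    let ?q = "pt (p $ 0) (p $ 1) (p $ 2) z1"
    have q: "?q \<in> U" using nth_in_U[OF p] z1 by simp
    let ?Q = "\<lambda>i a. pderiv i (\<lambda>q. X q $ a) ?q"
    have "?Q 0 1 = 0" "?Q 0 2 = 0" "?Q 0 3 = 0"
      using lie(2)[OF q] D z1 unfolding lie_torsion_zero_iff[OF q] x_def by auto
    moreover from this have "?Q 0 0 = 0"
      using lie(1)[OF q] unfolding lie_metric_zero_iff[OF q] by auto
    ultimately have "\<forall>a. ?Q 0 a = 0" by (simp add: forall_4_from_0)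
    then have "((\<lambda>t. X (pt t (p $ 1) (p $ 2) z1) $ a) has_real_derivative 0) (at (p $ 0))"
      using DERIV_pt(1)[OF algebra_component_differentiable[OF X q], of a] by simp
    moreover have "X (pt t (p $ 1) (p $ 2) z1) $ a = X (pt t (p $ 1) (p $ 2) (p $ 3)) $ a" for t
      using pderiv_zero_imp_indep(4)[OF algebra_component_differentiable[OF X] P3] z1 nth_in_U[OF p]
      by blast
    moreover have "((\<lambda>t. X (pt t (p $ 1) (p $ 2) (p $ 3)) $ a) has_real_derivative P 0 a) (at (p $ 0))"
      using DERIV_pt(1)[of "\<lambda>q. X q $ a" "p $ 0" "p $ 1" "p $ 2" "p $ 3"]
        algebra_component_differentiable[OF X p] by (simp add: P_def)
    ultimately show ?thesis using DERIV_unique by auto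
  qed
  show "P 1 1 = 0" by (rule M)
  show P20: "P 2 0 = - H x * P 2 2 - 2 * \<omega> * D x * X p $ 1"
    using M(3) P0 by simp
  have "D x * (deriv D x * X p $ 1 + D x * P 2 2) = 0"
    using M(6) by (simp add: P20 algebra_simps power2_eq_square)
  then have "deriv D x * X p $ 1 + D x * P 2 2 = 0" using D by simp
  then show "P 2 2 = - deriv D x / D x * X p $ 1" using D by (simp add: field_simps)
  show P10: "P 1 0 = - H x * P 1 2"
    using M(2) P0 by simp
  have "(D x)\<^sup>2 * P 1 2 = - P 2 1"
    using M(5) by (simp add: P10 algebra_simps power2_eq_square)
  then show "P 1 2 = - P 2 1 / (D x)\<^sup>2" using D by (simp add: field_simps)
qed

section \<open>Rigidity: a motion is determined by four numbers at a point\<close>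

lemma DERIV_log_deriv_D:
  obtains k where "\<And>x. x \<in> I \<Longrightarrow> ((\<lambda>x. deriv D x / D x) has_real_derivative k / (D x)\<^sup>2) (at x)"
proof (cases "I = {}")
  case False
  then obtain x0 where x0: "x0 \<in> I" by blast
  \<comment> \<open>A first integral of D'' = m2 D; it is also D D'' - D'^2, the numerator of the
    derivative of D'/D.\<close>
  let ?k = "\<lambda>x. m2 * (D x)\<^sup>2 - (deriv D x)\<^sup>2"
  show thesis
  proof (rule that[of "?k x0"])
    fix x assume x: "x \<in> I"
    have "?k x0 = ?k x"
      by (rule interval_zero_deriv_imp_eq[OF interval_I _ x0 x])
        (auto intro!: derivative_eq_intros DERIV_D DERIV_deriv_D)
    then show "((\<lambda>x. deriv D x / D x) has_real_derivative ?k x0 / (D x)\<^sup>2) (at x)"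
      using D_nonzero[OF x]
      by (auto intro!: derivative_eq_intros DERIV_D[OF x] DERIV_deriv_D[OF x]
          simp: field_simps power2_eq_square)
  qed
qed (use that in auto)

lemma antiderivative_inverse_D_square:
  assumes "x0 \<in> I"
  obtains F where "F x0 = 0" "\<And>x. x \<in> I \<Longrightarrow> (F has_real_derivative 1 / (D x)\<^sup>2) (at x)"
proof (rule open_interval_antiderivative[OF open_I interval_I assms])
  show "continuous_on I (\<lambda>x. 1 / (D x)\<^sup>2)"
    using D_nonzero DERIV_continuous_on[OF DERIV_subset[OF DERIV_D]]
    by (intro continuous_intros) auto
qed (use that in blast)

text \<open>X^x depends on y alone; as a function \<open>b\<close> of y it solves b'' = k b with
  zero initial data, hence vanishes. Then all first derivatives of X vanish, and following
  coordinate lines from \<open>p\<close> to \<open>P\<close> gives X = 0.\<close>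

lemma algebra_rigid:
  assumes X: "X \<in> \<A>" and P: "P \<in> U" and XP: "X P = 0"
    and X1P: "pderiv 2 (\<lambda>q. X q $ 1) P = 0" and p: "p \<in> U"
  shows "X p = 0"
proof -
  define t0 x0 y0 z0 where defs: "t0 = P $ 0" "x0 = P $ 1" "y0 = P $ 2" "z0 = P $ 3"
  have x0: "x0 \<in> I" and z0: "z0 \<in> J" using nth_in_U[OF P] by (auto simp: defs)
  have P_eq: "P = pt t0 x0 y0 z0" by (simp add: defs)
  note diff = algebra_component_differentiable[OF X]
  have indep: "X (pt t x y z) $ a = X (pt t0 x y z0) $ a" if "x \<in> I" "z \<in> J" for t x y z a
  proof -
    have "X (pt t x y z) $ a = X (pt t0 x y z) $ a"
      by (rule pderiv_zero_imp_indep(1)[OF diff algebra_equations(1)[OF X]]) (use that in auto)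
    also have "\<dots> = X (pt t0 x y z0) $ a"
      by (rule pderiv_zero_imp_indep(4)[OF diff algebra_equations(2)[OF X]]) (use that z0 in auto)
    finally show ?thesis .
  qed
  define b b' C where "b y = X (pt t0 x0 y z0) $ 1"
    and "b' y = pderiv 2 (\<lambda>q. X q $ 1) (pt t0 x0 y z0)"
    and "C x y = X (pt t0 x y z0) $ 2" for x y
  obtain F where F: "F x0 = 0" "\<And>x. x \<in> I \<Longrightarrow> (F has_real_derivative 1 / (D x)\<^sup>2) (at x)"
    using antiderivative_inverse_D_square[OF x0] by blast
  obtain k where k: "\<And>x. x \<in> I \<Longrightarrow> ((\<lambda>x. deriv D x / D x) has_real_derivative k / (D x)\<^sup>2) (at x)"
    using DERIV_log_deriv_D by blast
  have X1: "X (pt t0 x y z0) $ 1 = b y" if "x \<in> I" for x y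
    unfolding b_def using pderiv_zero_imp_indep(2)[OF diff algebra_equations(3)[OF X]] that x0 z0 by blast
  have db: "(b has_real_derivative b' y) (at y)" for y
    unfolding b_def b'_def using DERIV_pt(3)[of "\<lambda>q. X q $ 1"] diff x0 z0 by simp
  have P21: "pderiv 2 (\<lambda>q. X q $ 1) (pt t0 x y z0) = b' y" if "x \<in> I" for x y
  proof -
    have "((\<lambda>y. X (pt t0 x y z0) $ 1) has_real_derivative pderiv 2 (\<lambda>q. X q $ 1) (pt t0 x y z0)) (at y)"
      by (rule DERIV_pt(3)[OF diff]) (use that z0 in simp)
    then have "(b has_real_derivative pderiv 2 (\<lambda>q. X q $ 1) (pt t0 x y z0)) (at y)"
      unfolding X1[OF that] .
    then show ?thesis by (rule DERIV_unique[OF _ db])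
  qed
  have Cx: "((\<lambda>x. C x y) has_real_derivative - b' y / (D x)\<^sup>2) (at x)" if "x \<in> I" for x y
    unfolding C_def using DERIV_pt(2)[of "\<lambda>q. X q $ 2" t0 x y z0] diff that z0
      algebra_equations(6)[OF X, of "pt t0 x y z0"] by (simp add: P21)
  have Cy: "(C x has_real_derivative - deriv D x / D x * b y) (at y)" if "x \<in> I" for x y
    unfolding C_def using DERIV_pt(3)[of "\<lambda>q. X q $ 2" t0 x y z0] diff that z0
      algebra_equations(4)[OF X, of "pt t0 x y z0"] by (simp add: X1)
  obtain r where r: "r > 0" "cball x0 r \<subseteq> I"
    using open_I x0 open_contains_cball by blast
  have sub: "x \<in> I" if "x0 \<le> x" "x \<le> x0 + r" for x
    using r that by (auto simp: subset_iff dist_real_def)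
  \<comment> \<open>F' = 1/D^2 is positive, so some \<open>x1\<close> has \<open>F x1\<close>
    nonzero and can serve as a divisor when solving for \<open>b'\<close>.\<close>
  have "F x0 < F (x0 + r)"
  proof (rule DERIV_pos_imp_increasing[of x0 "x0 + r" F])
    show "\<exists>y. (F has_real_derivative y) (at x) \<and> 0 < y" if "x0 \<le> x" "x \<le> x0 + r" for x
      using F(2)[OF sub[OF that]] D_nonzero[OF sub[OF that]] by (intro exI[of _ "1 / (D x)\<^sup>2"]) simp
  qed (use r in simp)
  then obtain x1 where x1: "x1 \<in> I" "F x1 \<noteq> 0"
    using F(1) sub[of "x0 + r"] r(1) by auto
  \<comment> \<open>Integrating \<open>\<partial>\<^sub>x C\<close> from \<open>x0\<close> to \<open>x1\<close> expresses \<open>b'\<close> through \<open>C\<close>; differentiating the result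
    in \<open>y\<close> gives \<open>b'' = k b\<close> without interchanging partial derivatives.\<close>
  have "C x1 y - C x0 y = - b' y * F x1" for y
  proof -
    have "C x1 y + b' y * F x1 = C x0 y + b' y * F x0"
      by (rule interval_zero_deriv_imp_eq[OF interval_I _ x1(1) x0])
        (auto intro!: derivative_eq_intros Cx F(2))
    then show ?thesis by (simp add: F)
  qed
  then have b'_eq: "b' = (\<lambda>y. - (C x1 y - C x0 y) / F x1)"
    using x1 by (auto simp: field_simps)
  \<comment> \<open>D'/D and k F have the same derivative k/D^2; hence the increment of D'/D is
    \<open>k * F x1\<close>, and the divisor \<open>F x1\<close> cancels in b''.\<close>
  have "deriv D x1 / D x1 - k * F x1 = deriv D x0 / D x0 - k * F x0"
  proof (rule interval_zero_deriv_imp_eq[OF interval_I _ x1(1) x0])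
    fix x assume "x \<in> I"
    from DERIV_diff[OF k DERIV_cmult[OF F(2)], OF this this, of k]
    show "((\<lambda>x. deriv D x / D x - k * F x) has_real_derivative 0) (at x)" by simp
  qed
  then have kF: "deriv D x1 / D x1 - deriv D x0 / D x0 = k * F x1" by (simp add: F)
  have "(b' has_real_derivative k * b y) (at y)" for y
  proof -
    have "(b' has_real_derivative (deriv D x1 / D x1 - deriv D x0 / D x0) * b y / F x1) (at y)"
      unfolding b'_eq using x1 
      by (auto intro!: derivative_eq_intros Cy x0 simp: field_simps)
    then show ?thesis using x1 by (simp add: kF)
  qed
  with db have b0: "b y = 0" for y
    by (rule linear_oscillator_zero[of b b' k y0]) (use XP X1P in \<open>simp_all add: P_eq b_def b'_def\<close>)
  have X1_zero: "X q $ 1 = 0" if "q \<in> U" for q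
    using indep[of "q $ 1" "q $ 3" "q $ 0" "q $ 2" 1] X1[of "q $ 1" "q $ 2"] b0 nth_in_U[OF that] by simp
  have zero: "pderiv 2 (\<lambda>q. X q $ 1) q = 0" if "q \<in> U" for q
    by (rule pderiv_zero_on_U[OF X1_zero that])
  \<comment> \<open>With X^x = 0 and its y-derivative zero, every right-hand side in
    \<open>algebra_equations\<close> vanishes.\<close>
  have d: "pderiv i (\<lambda>q. X q $ a) q = 0" if "q \<in> U" "i = 1 \<or> i = 2" for q i a
  proof -
    have "pderiv i (\<lambda>q. X q $ 0) q = 0" "pderiv i (\<lambda>q. X q $ 2) q = 0"
      using algebra_equations[OF X that(1)] that(2) zero[OF that(1)] X1_zero[OF that(1)] by auto
    moreover have "pderiv i (\<lambda>q. X q $ 3) q = 0" "pderiv i (\<lambda>q. X q $ 1) q = 0"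
      by (rule pderiv_zero_on_U[OF _ that(1)], simp add: X1_zero algebra_z_component_zero[OF X])+
    ultimately have "\<forall>a. pderiv i (\<lambda>q. X q $ a) q = 0" by (simp add: forall_4_from_0)
    then show ?thesis by blast
  qed
  have "X p $ a = 0" for a
  proof -
    have "X p $ a = X (pt t0 (p $ 1) (p $ 2) z0) $ a"
      using indep[of "p $ 1" "p $ 3" "p $ 0" "p $ 2"] nth_in_U[OF p] by simp
    also have "\<dots> = X (pt t0 x0 (p $ 2) z0) $ a"
      by (rule pderiv_zero_imp_indep(2)[OF diff d]) (use nth_in_U[OF p] x0 z0 in auto)
    also have "\<dots> = X (pt t0 x0 y0 z0) $ a"
      by (rule pderiv_zero_imp_indep(3)[OF diff d]) (use x0 z0 in auto)
    finally show ?thesis using XP by (simp add: P_eq)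
  qed
  then show ?thesis by (simp add: vec_eq_iff)
qed

subsection \<open>Explicit motions\<close>

text \<open>
  The general solution of the Lie equations, in terms of a solution of \<open>W' = b\<close>, \<open>b' = k W + e\<close> and of
  the antiderivatives \<open>F\<close>, \<open>K\<close> of \<open>1 / D\<^sup>2\<close> and \<open>H' F\<close>.
\<close>

definition motion_field ::
    "(real \<Rightarrow> real) \<Rightarrow> (real \<Rightarrow> real) \<Rightarrow> (real \<Rightarrow> real) \<Rightarrow> (real \<Rightarrow> real) \<Rightarrow> real \<Rightarrow> real \<Rightarrow> real \<Rightarrow> vfield" where
  "motion_field F K W b e a c p =
    (if p \<in> U then
       pt ((H (p $ 1) * (deriv D (p $ 1) / D (p $ 1)) - 2 * \<omega> * D (p $ 1)) * W (p $ 2)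
             + (e * (H (p $ 1) * F (p $ 1) - K (p $ 1)) + a))
          (b (p $ 2))
          (- (deriv D (p $ 1) / D (p $ 1)) * W (p $ 2) + (c - e * F (p $ 1)))
          0
     else 0)"

text \<open>X^y integrates the equations for its x- and y-derivatives. In X^t the terms -2 \<omega>
  D W and -e K cancel what differentiating H produces, leaving dX^t/dx = -H dX^y/dx and dX^t/dy = -H
  dX^y/dy - H' X^x, as \<open>algebra_equations\<close> demands.\<close>

lemma motion_field:
  fixes a c :: real
  assumes k: "\<And>x. x \<in> I \<Longrightarrow> ((\<lambda>x. deriv D x / D x) has_real_derivative k / (D x)\<^sup>2) (at x)"
    and F: "\<And>x. x \<in> I \<Longrightarrow> (F has_real_derivative 1 / (D x)\<^sup>2) (at x)"
    and K: "\<And>x. x \<in> I \<Longrightarrow> (K has_real_derivative 2 * \<omega> * D x * F x) (at x)"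
    and W: "\<And>y. (W has_real_derivative b y) (at y)"
    and b: "\<And>y. (b has_real_derivative k * W y + e) (at y)"
  defines "X \<equiv> motion_field F K W b e a c"
  shows "X \<in> \<A>" and "p \<in> U \<Longrightarrow> pderiv 2 (\<lambda>q. X q $ 1) p = k * W (p $ 2) + e"
proof -
  let ?L = "\<lambda>x. deriv D x / D x"
  let ?\<mu> = "\<lambda>x. H x * ?L x - 2 * \<omega> * D x" and ?\<nu> = "\<lambda>x. e * (H x * F x - K x) + a"
  have X: "X q $ 0 = ?\<mu> (q $ 1) * W (q $ 2) + ?\<nu> (q $ 1)" "X q $ 1 = b (q $ 2)"
    "X q $ 2 = - ?L (q $ 1) * W (q $ 2) + (c - e * F (q $ 1))" "X q $ 3 = 0" if "q \<in> U" for q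
    using that by (simp_all add: X_def motion_field_def)
  have d\<mu>: "(?\<mu> has_real_derivative H x * (k / (D x)\<^sup>2)) (at x)" if "x \<in> I" for x
  proof -
    have "(?\<mu> has_real_derivative (2 * \<omega> * D x * ?L x + k / (D x)\<^sup>2 * H x) - 2 * \<omega> * deriv D x) (at x)"
      by (intro DERIV_diff DERIV_mult DERIV_cmult DERIV_H DERIV_D k that)
    then show ?thesis using D_nonzero[OF that] by (simp add: ac_simps)
  qed
  have d\<nu>: "(?\<nu> has_real_derivative e * (H x / (D x)\<^sup>2)) (at x)" if "x \<in> I" for x
  proof -
    have "(?\<nu> has_real_derivative e * ((2 * \<omega> * D x * F x + 1 / (D x)\<^sup>2 * H x) - 2 * \<omega> * D x * F x) + 0) (at x)"
      by (intro DERIV_add DERIV_diff DERIV_mult DERIV_cmult DERIV_H DERIV_const F K that)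
    then show ?thesis by simp
  qed
  have dc: "((\<lambda>x. c - e * F x) has_real_derivative 0 - e * (1 / (D x)\<^sup>2)) (at x)" if "x \<in> I" for x
    by (intro DERIV_diff DERIV_cmult DERIV_const F that)
  have P0: "pderiv i (\<lambda>q. X q $ 0) p =
      (if i = 1 then H (p $ 1) * (k / (D (p $ 1))\<^sup>2) * W (p $ 2) + e * (H (p $ 1) / (D (p $ 1))\<^sup>2)
       else if i = 2 then ?\<mu> (p $ 1) * b (p $ 2) else 0)" if "p \<in> U" for i p
    by (rule pderiv_separated[OF that _ d\<mu>[OF nth_in_U(1)[OF that]] W d\<nu>[OF nth_in_U(1)[OF that]] X(1)]) simp_all
  have P1: "pderiv i (\<lambda>q. X q $ 1) p = (if i = 2 then k * W (p $ 2) + e else 0)" if "p \<in> U" for i p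
    using pderiv_separated[OF that _ DERIV_const b DERIV_const, of 2 "\<lambda>q. X q $ 1" 1 0 i] X(2) by simp
  have P2: "pderiv i (\<lambda>q. X q $ 2) p =
      (if i = 1 then - (k / (D (p $ 1))\<^sup>2) * W (p $ 2) + (0 - e * (1 / (D (p $ 1))\<^sup>2))
       else if i = 2 then - ?L (p $ 1) * b (p $ 2) else 0)" if "p \<in> U" for i p
    by (rule pderiv_separated[OF that _ DERIV_minus[OF k[OF nth_in_U(1)[OF that]]] W dc[OF nth_in_U(1)[OF that]] X(3)])
      simp_all
  have P3: "pderiv i (\<lambda>q. X q $ 3) p = 0" if "p \<in> U" for i p
    by (rule pderiv_zero_on_U[OF X(4) that])
  show "p \<in> U \<Longrightarrow> pderiv 2 (\<lambda>q. X q $ 1) p = k * W (p $ 2) + e" by (simp add: P1)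

  have sD: "smooth_on I (\<lambda>x. inverse (D x))"
    using D_nonzero by (intro smooth_on_inverse[OF open_I smooth_D])
  have "smooth_on I (\<lambda>x. inverse (D x) * inverse (D x))"
    by (intro smooth_on_mult[OF open_I] sD)
  then have sF: "smooth_on I F"
    by (intro smooth_on_realI[OF open_I F]) (simp_all add: divide_inverse power2_eq_square)
  have "smooth_on I (\<lambda>x. 2 * \<omega> * D x * F x)"
    by (intro smooth_on_mult[OF open_I] smooth_on_const smooth_D sF)
  then have sK: "smooth_on I K"
    by (intro smooth_on_realI[OF open_I K])
  have sL: "smooth_on I (\<lambda>x. deriv D x * inverse (D x))"
    by (intro smooth_on_mult[OF open_I] smooth_on_deriv[OF open_I smooth_D] sD)
  have s\<mu>: "smooth_on I ?\<mu>" and s\<nu>: "smooth_on I ?\<nu>" and sc: "smooth_on I (\<lambda>x. c - e * F x)"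
    and sL': "smooth_on I (\<lambda>x. - 1 * (deriv D x * inverse (D x)))"
    unfolding divide_inverse
    by (intro smooth_on_add[OF open_I] smooth_on_diff[OF open_I] smooth_on_mult[OF open_I]
        smooth_on_const smooth_H smooth_D sL sF sK)+
  have W_smooth: "smooth_on UNIV W" "smooth_on UNIV b"
    using smooth_on_second_order_ode[OF W b] by auto
  have cx: "smooth_on U (\<lambda>q. \<phi> (q $ 1))" if "smooth_on I \<phi>" for \<phi> :: "real \<Rightarrow> real"
    using smooth_on_compose_nth[OF open_U nth_in_U(1) that] .
  have cy: "smooth_on U (\<lambda>q. \<phi> (q $ 2))" if "smooth_on UNIV \<phi>" for \<phi> :: "real \<Rightarrow> real"
    using smooth_on_compose_nth[OF open_U UNIV_I that] .
  have "smooth_on U (\<lambda>q. X q $ 0)"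
    by (rule smooth_on_cong[OF open_U _
          smooth_on_add[OF open_U smooth_on_mult[OF open_U cx[OF s\<mu>] cy[OF W_smooth(1)]] cx[OF s\<nu>]]])
      (simp add: X(1))
  moreover have "smooth_on U (\<lambda>q. X q $ 1)"
    by (rule smooth_on_cong[OF open_U X(2)[symmetric] cy[OF W_smooth(2)]])
  moreover have "smooth_on U (\<lambda>q. X q $ 2)"
    by (rule smooth_on_cong[OF open_U _
          smooth_on_add[OF open_U smooth_on_mult[OF open_U cx[OF sL'] cy[OF W_smooth(1)]] cx[OF sc]]])
      (simp add: X(3) divide_inverse)
  moreover have "smooth_on U (\<lambda>q. X q $ 3)"
    by (rule smooth_on_cong[OF open_U X(4)[symmetric] smooth_on_const])
  ultimately have "\<forall>i. smooth_on U (\<lambda>q. X q $ i)" by (simp add: forall_4_from_0)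
  then have "smooth_on U X" by (intro smooth_on_vecI[OF open_U]) blast
  moreover have "\<forall>a b. lie_metric X g p a b = 0" if p: "p \<in> U" for p
    unfolding lie_metric_zero_iff[OF p]
    using D_nonzero[OF nth_in_U(1)[OF p]] p
    by (simp add: P0 P1 P2 P3 X) (simp add: field_simps power2_eq_square)
  moreover have "\<forall>a b c. lie_torsion X (torsion \<Gamma>) p a b c = 0" if p: "p \<in> U" for p
    unfolding lie_torsion_zero_iff[OF p]
    using D_nonzero[OF nth_in_U(1)[OF p]] p
    by (simp add: P0 P1 P2 P3 X)
  ultimately show "X \<in> \<A>"
    by (auto simp: affine_isometry_algebra_def X_def motion_field_def)
qed

text \<open>Four motions dual to the data X^t, X^x, X^y and dX^x/dy at \<open>P\<close>. Subtracting
  from X the combination with the same data leaves a motion that \<open>algebra_rigid\<close> shows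
  to be zero.\<close>

lemma adapted_basis:
  assumes P: "P \<in> U"
  obtains E0 E1 E2 R where "E0 \<in> \<A>" "E1 \<in> \<A>" "E2 \<in> \<A>" "R \<in> \<A>"
    and "E0 P = axis 0 1" "E1 P = axis 1 1" "E2 P = axis 2 1" "R P = 0" "R \<noteq> 0"
    and "\<And>X. X \<in> \<A> \<Longrightarrow> \<exists>r. X = vf_scale (X P $ 0) E0 + vf_scale (X P $ 1) E1
          + vf_scale (X P $ 2) E2 + vf_scale r R"
proof -
  define x0 y0 where "x0 = P $ 1" and "y0 = P $ 2"
  have x0: "x0 \<in> I" using nth_in_U[OF P] by (simp add: x0_def)
  obtain k where k: "\<And>x. x \<in> I \<Longrightarrow> ((\<lambda>x. deriv D x / D x) has_real_derivative k / (D x)\<^sup>2) (at x)"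
    using DERIV_log_deriv_D by blast
  obtain F where F: "F x0 = 0" "\<And>x. x \<in> I \<Longrightarrow> (F has_real_derivative 1 / (D x)\<^sup>2) (at x)"
    using antiderivative_inverse_D_square[OF x0] by blast
  have "continuous_on I (\<lambda>x. 2 * \<omega> * D x * F x)"
    by (intro continuous_intros DERIV_continuous_on[OF DERIV_subset[OF DERIV_D]]
        DERIV_continuous_on[OF DERIV_subset[OF F(2)]]) auto
  then obtain K where K: "K x0 = 0" "\<And>x. x \<in> I \<Longrightarrow> (K has_real_derivative 2 * \<omega> * D x * F x) (at x)"
    using open_interval_antiderivative[OF open_I interval_I x0] by blast
  obtain s c w :: "real \<Rightarrow> real" where scw: "s 0 = 0" "c 0 = 1" "w 0 = 0"
    "\<And>u. (s has_real_derivative c u) (at u)" "\<And>u. (c has_real_derivative k * s u) (at u)"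
    "\<And>u. (w has_real_derivative s u) (at u)" "\<And>u. c u = k * w u + 1"
    using constant_curvature_trig[of k] by blast
  have shift: "((\<lambda>y. f (y - y0)) has_real_derivative f' (y - y0)) (at y)"
    if "\<And>u. (f has_real_derivative f' u) (at u)" for f f' :: "real \<Rightarrow> real" and y
  proof -
    have "((\<lambda>y. y - y0) has_real_derivative 1) (at y)" by (auto intro!: derivative_eq_intros)
    from DERIV_chain2[OF that this] show ?thesis by simp
  qed
  \<comment> \<open>On \<open>U\<close>, \<open>E0\<close> and \<open>E2\<close> are the coordinate
    fields of t and y. Shifting by \<open>y0\<close> gives \<open>E1\<close> unit X^x and zero
    dX^x/dy at \<open>P\<close>; \<open>R\<close> has \<open>e\<close> = 1, so it vanishes at
    \<open>P\<close> while its dX^x/dy there is 1.\<close>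
  define E0 E1 E2 R where "E0 = motion_field F K (\<lambda>y. 0) (\<lambda>y. 0) 0 1 0"
    and "E1 = motion_field F K (\<lambda>y. s (y - y0)) (\<lambda>y. c (y - y0)) 0 0 0"
    and "E2 = motion_field F K (\<lambda>y. 0) (\<lambda>y. 0) 0 0 1"
    and "R = motion_field F K (\<lambda>y. w (y - y0)) (\<lambda>y. s (y - y0)) 1 0 0"
  note mf = motion_field[OF k F(2) K(2)]
  have E: "E0 \<in> \<A>" "E1 \<in> \<A>" "E2 \<in> \<A>" "R \<in> \<A>"
    unfolding E0_def E1_def E2_def R_def
    by (rule mf(1); use shift[OF scw(4)] shift[OF scw(5)] shift[OF scw(6)] scw(7) in simp)+
  have dE: "pderiv 2 (\<lambda>q. E0 q $ 1) P = k * 0 + 0"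
    "pderiv 2 (\<lambda>q. E1 q $ 1) P = k * s (P $ 2 - y0) + 0"
    "pderiv 2 (\<lambda>q. E2 q $ 1) P = k * 0 + 0"
    "pderiv 2 (\<lambda>q. R q $ 1) P = k * w (P $ 2 - y0) + 1"
    unfolding E0_def E1_def E2_def R_def
    by (rule mf(2); use P shift[OF scw(4)] shift[OF scw(5)] shift[OF scw(6)] scw(7) in simp)+
  have EP: "E0 P = axis 0 1" "E1 P = axis 1 1" "E2 P = axis 2 1" "R P = 0"
    using P by (simp_all add: E0_def E1_def E2_def R_def motion_field_def vec4_eq_iff axis_def
        scw F(1) K(1) flip: x0_def y0_def)
  have "R \<noteq> 0" using dE(4) by (auto simp: pderiv_def y0_def scw zero_fun_def)
  moreover have "\<exists>r. X = vf_scale (X P $ 0) E0 + vf_scale (X P $ 1) E1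
      + vf_scale (X P $ 2) E2 + vf_scale r R" if X: "X \<in> \<A>" for X
  proof -
    define r where "r = pderiv 2 (\<lambda>q. X q $ 1) P"
    define Z where "Z = vf_scale (X P $ 0) E0 + vf_scale (X P $ 1) E1 + vf_scale (X P $ 2) E2 + vf_scale r R"
    have sub: "vf.subspace \<A>" by (rule subspace_affine_isometry_algebra[OF open_U])
    have XZ: "X - Z \<in> \<A>"
      unfolding Z_def by (intro vf.subspace_diff[OF sub] vf.subspace_add[OF sub] vf.subspace_scale[OF sub] X E)
    have "X P $ 3 = 0" by (rule algebra_z_component_zero[OF X P])
    then have "(X - Z) P = 0"
      by (simp add: Z_def vf_scale_def EP vec4_eq_iff axis_def)
    \<comment> \<open>Linearity of the fourth datum is read off on the y-line through
      \<open>P\<close>, where \<open>pderiv 2\<close> is an ordinary derivative.\<close>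
    moreover have "pderiv 2 (\<lambda>q. (X - Z) q $ 1) P = 0"
    proof -
      let ?c = "\<lambda>Y y. Y (pt (P $ 0) (P $ 1) y (P $ 3)) $ 1"
      have d: "((\<lambda>y. ?c Y y) has_real_derivative pderiv 2 (\<lambda>q. Y q $ 1) P) (at (P $ 2))" if "Y \<in> \<A>" for Y
        using DERIV_pt(3)[of "\<lambda>q. Y q $ 1" "P $ 0" "P $ 1" "P $ 2" "P $ 3"]
          algebra_component_differentiable[OF that P] by simp
      have "((\<lambda>y. ?c X y - (X P $ 0 * ?c E0 y + X P $ 1 * ?c E1 y + X P $ 2 * ?c E2 y + r * ?c R y))
          has_real_derivative r - (X P $ 0 * 0 + X P $ 1 * 0 + X P $ 2 * 0 + r * 1)) (at (P $ 2))"
        using d[OF E(1)] d[OF E(2)] d[OF E(3)] d[OF E(4)] d[OF X] unfolding dE r_def[symmetric]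
        by (intro DERIV_diff DERIV_add DERIV_cmult) (simp_all add: y0_def scw)
      then have "((\<lambda>y. ?c (X - Z) y) has_real_derivative 0) (at (P $ 2))"
        by (simp add: Z_def vf_scale_def)
      with d[OF XZ] show ?thesis by (rule DERIV_unique)
    qed
    ultimately have 0: "(X - Z) p = 0" if "p \<in> U" for p
      using algebra_rigid[OF XZ P] that by blast
    \<comment> \<open>Outside \<open>U\<close> both fields vanish by convention, so they agree as
      total functions.\<close>
    have "X p = Z p" for p
    proof (cases "p \<in> U")
      case True
      then show ?thesis using 0[OF True] by simp
    next
      case False
      then show ?thesis using XZ by (auto simp: affine_isometry_algebra_def)
    qed
    then show ?thesis unfolding Z_def by blast
  qed
  ultimately show thesis using that E EP by blast
qed

section \<open>Dimensions of the algebra, the isotropy and the orbit\<close>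

lemma span_component_zero:
  assumes "Y \<in> vf.span B" "\<forall>Z\<in>B. Z P $ i = 0"
  shows "Y P $ i = 0"
proof -
  have "vf.subspace {Z. Z P $ i = 0}"
    by (rule vf.subspaceI) (simp_all add: vf_scale_def)
  moreover have "B \<subseteq> {Z. Z P $ i = 0}" using assms(2) by blast
  ultimately show ?thesis using vf.span_minimal assms(1) by blast
qed

lemma algebra_dims:
  assumes P: "P \<in> U"
  shows "vf.dim \<A> = 4" "vf.dim (isotropy_algebra \<A> P) = 1" "orbit_dim \<A> P = 3"
proof -
  obtain E0 E1 E2 R where E: "E0 \<in> \<A>" "E1 \<in> \<A>" "E2 \<in> \<A>" "R \<in> \<A>"
    and EP: "E0 P = axis 0 1" "E1 P = axis 1 1" "E2 P = axis 2 1" "R P = 0" and "R \<noteq> 0"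
    and rep: "\<And>X. X \<in> \<A> \<Longrightarrow> \<exists>r. X = vf_scale (X P $ 0) E0 + vf_scale (X P $ 1) E1
          + vf_scale (X P $ 2) E2 + vf_scale r R"
    using adapted_basis[OF P] by metis
  have comp: "axis i (1 :: real) $ j = (if i = j then 1 else 0)" for i j :: 4
    by (simp add: axis_def)
  \<comment> \<open>Independence is peeled off one field at a time: each has a component 1 at
    \<open>P\<close> where all remaining fields have 0. \<open>R\<close> vanishes at
    \<open>P\<close> and enters last, through \<open>R \<noteq> 0\<close>.\<close>
  have E2: "E2 \<notin> vf.span {E1, E0, R}"
    using span_component_zero[of E2 "{E1, E0, R}" P 2] by (auto simp: EP comp)
  have E1: "E1 \<notin> vf.span {E0, R}"
    using span_component_zero[of E1 "{E0, R}" P 1] by (auto simp: EP comp)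
  have E0: "E0 \<notin> vf.span {R}"
    using span_component_zero[of E0 "{R}" P 0] by (auto simp: EP comp)
  have ind: "vf.independent {R}" using \<open>R \<noteq> 0\<close> by (simp add: vf.independent_insert)
  show "vf.dim \<A> = 4"
  proof (rule vf.dim_unique)
    show "{E2, E1, E0, R} \<subseteq> \<A>" using E by simp
    show "\<A> \<subseteq> vf.span {E2, E1, E0, R}"
    proof
      fix X assume "X \<in> \<A>"
      from rep[OF this] obtain r where "X = vf_scale (X P $ 0) E0 + vf_scale (X P $ 1) E1
          + vf_scale (X P $ 2) E2 + vf_scale r R" ..
      moreover have "\<dots> \<in> vf.span {E2, E1, E0, R}"
        by (intro vf.span_add vf.span_scale vf.span_base) auto
      ultimately show "X \<in> vf.span {E2, E1, E0, R}" by (simp only:)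
    qed
    show "vf.independent {E2, E1, E0, R}"
      using E0 E1 E2 ind by (simp add: vf.independent_insert)
    have "E2 \<notin> {E1, E0, R}" "E1 \<notin> {E0, R}" "E0 \<notin> {R}"
      using E0 E1 E2 vf.span_superset[of "{E1, E0, R}"] vf.span_superset[of "{E0, R}"]
        vf.span_superset[of "{R}"] by fast+
    then show "card {E2, E1, E0, R} = 4" by simp
  qed
  show "vf.dim (isotropy_algebra \<A> P) = 1"
  proof (rule vf.dim_unique)
    show "{R} \<subseteq> isotropy_algebra \<A> P" using E EP by (simp add: isotropy_algebra_def)
    show "isotropy_algebra \<A> P \<subseteq> vf.span {R}"
    proof
      fix X assume X: "X \<in> isotropy_algebra \<A> P"
      then have "X \<in> \<A>" "X P = 0" by (simp_all add: isotropy_algebra_def)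
      with rep[of X] obtain r where "X = vf_scale 0 E0 + vf_scale 0 E1 + vf_scale 0 E2 + vf_scale r R"
        by auto
      then have "X = vf_scale r R" by simp
      then show "X \<in> vf.span {R}" by (simp add: vf.span_base vf.span_scale)
    qed
  qed (use ind in simp_all)
  have "dim ((\<lambda>X. X P) ` \<A>) = 3"
  proof (rule dim_unique)
    let ?B = "{axis 0 1, axis 1 1, axis 2 1 :: real ^ 4}"
    show "?B \<subseteq> (\<lambda>X. X P) ` \<A>" using E EP by (metis (no_types, lifting) empty_subsetI image_eqI insert_subset)
    show "(\<lambda>X. X P) ` \<A> \<subseteq> span ?B"
    proof clarify
      fix X assume X: "X \<in> \<A>"
      have "X P = (X P $ 0) *\<^sub>R axis 0 1 + (X P $ 1) *\<^sub>R axis 1 1 + (X P $ 2) *\<^sub>R axis 2 1"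
        using algebra_z_component_zero[OF X P] by (simp add: vec4_eq_iff comp)
      moreover have "\<dots> \<in> span ?B" by (intro span_add span_scale span_base) auto
      ultimately show "X P \<in> span ?B" by (simp only:)
    qed
    show "independent ?B"
      by (rule independent_mono[OF independent_Basis]) (simp add: axis_in_Basis_iff)
    show "card ?B = 3" by (simp add: axis_eq_axis)
  qed
  then show "orbit_dim \<A> P = 3" by (simp add: orbit_dim_def dim_span)
qed

section \<open>Orbits and failure of homogeneity\<close>

lemma local_orbit_z_constant:
  assumes "q \<in> local_orbit U \<A> P"
  shows "q $ 3 = P $ 3"
  using assms
proof induction
  case start
  show ?case ..
next
  case (flow \<gamma> X \<tau>)
  \<comment> \<open>Along a flow line the z-coordinate has derivative X^z = 0.\<close>
  have "\<exists>c. \<forall>s\<in>{0..\<tau>}. \<gamma> s $ 3 = c"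
  proof (rule has_field_derivative_zero_constant)
    fix s assume s: "s \<in> {0..\<tau>}"
    have "((\<lambda>s. \<gamma> s $ 3) has_vector_derivative X (\<gamma> s) $ 3) (at s within {0..\<tau>})"
      by (rule bounded_linear.has_vector_derivative[OF bounded_linear_vec_nth flow(5)[OF s]])
    then show "((\<lambda>s. \<gamma> s $ 3) has_field_derivative 0) (at s within {0..\<tau>})"
      using algebra_z_component_zero[OF flow(2) flow(4)[OF s]]
      by (simp add: has_real_derivative_iff_has_vector_derivative)
  qed simp
  then have "\<gamma> \<tau> $ 3 = \<gamma> 0 $ 3" using flow(3) by auto
  then show ?case using flow by simp
qed

text \<open>Orbits stay in slices of constant z, so homogeneity would leave \<open>J\<close> with at
  most one point and make S constant. With \<open>I\<close> empty, homogeneity would hold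
  vacuously.\<close>

lemma not_homogeneous:
  assumes "I \<noteq> {}"
  shows "\<not> homogeneous_on U \<A>"
proof
  assume hom: "homogeneous_on U \<A>"
  obtain x where x: "x \<in> I" using assms by blast
  have "z = z'" if "z \<in> J" "z' \<in> J" for z z'
  proof -
    have "pt 0 x 0 z' \<in> local_orbit U \<A> (pt 0 x 0 z)"
      using hom x that by (simp add: homogeneous_on_def)
    from local_orbit_z_constant[OF this] show ?thesis by simp
  qed
  then have "S constant_on J" unfolding constant_on_def by metis
  with S_nonconstant show False ..
qed

end

theorem mainTheorem3:
  fixes I J :: "real set" and H D S :: "real \<Rightarrow> real" and \<omega> m2 :: real
    and U :: "(real ^ 4) set" and g :: tensor2 and \<Gamma> :: tensor3
  assumes "open I" "is_interval I" "I \<noteq> {}"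
    and "open J" "is_interval J" "J \<noteq> {}"
    and "U = {p. p $ 1 \<in> I \<and> p $ 3 \<in> J}"
    and "smooth_on I H" "smooth_on I D" "smooth_on J S"
    and "\<forall>x\<in>I. D x \<noteq> 0"
    and "riemann_cartan_on U g \<Gamma>"
    and line_element: "\<forall>p\<in>U. \<forall>v. metric_prod g p v v =
           (v $ 0 + H (p $ 1) * v $ 2)\<^sup>2 - (D (p $ 1))\<^sup>2 * (v $ 2)\<^sup>2 - (v $ 1)\<^sup>2 - (v $ 3)\<^sup>2"
    and torsion_components: "\<forall>p\<in>U. \<forall>a b c. torsion \<Gamma> p a b c =
           (if a = 0 \<and> b = 1 \<and> c = 2 then D (p $ 1) * S (p $ 3)
            else if a = 0 \<and> b = 2 \<and> c = 1 then - (D (p $ 1) * S (p $ 3))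
            else 0)"
    and "\<forall>x\<in>I. deriv H x / D x = 2 * \<omega>"
    and "\<forall>x\<in>I. deriv (deriv D) x / D x = m2"
    and "\<not> S constant_on J"
  shows "vf.dim (affine_isometry_algebra U g \<Gamma>) = 4 \<and>
         (\<forall>P\<in>U. vf.dim (isotropy_algebra (affine_isometry_algebra U g \<Gamma>) P) = 1 \<and>
                orbit_dim (affine_isometry_algebra U g \<Gamma>) P = 3) \<and>
         \<not> homogeneous_on U (affine_isometry_algebra U g \<Gamma>)"
proof -
  interpret goedel_type_torsion I J H D S \<omega> m2 U g \<Gamma>
    using assms by unfold_locales (auto simp: riemann_cartan_on_def lorentzian_on_def)
  \<comment> \<open>The dimension of the algebra is stated without a base point, but
    \<open>algebra_dims\<close> obtains it from one; hence some point of \<open>U\<close> must be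
    exhibited.\<close>
  have "pt 0 x 0 z \<in> U" if "x \<in> I" "z \<in> J" for x z using that by simp
  then show ?thesis
    using algebra_dims not_homogeneous assms(3,6) by blast
qed

end
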